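(* Let $N\ge2$, $\Omega\subset\mathbb{R}^N$ open, and let $\Phi,\Psi$ be Young functions such that $\int_0^1\left(\frac{s}{\Phi(s)}\right)^{\frac1{N-1}}ds<\infty$ in case $|\Omega|=\infty$, $\Phi,\tilde\Phi,\Psi\in\Delta'$, $\Phi<<\Psi$, and $\lim_{r\to0}\eta_{\Phi,\Psi}(r)<\infty$. If $g\in X_{\Phi,\Psi}(\Omega)$, then there is $C=C(N,\Phi,\Psi)>0$ such that for all $u\in\mathcal{C}^1_c(\Omega)$, \[ \Psi^{-1}\!\left(\int_\Omega|g(x)|\Psi(|u(x)|)\,dx\right)\le C\max\left\{\|g\|_{X_{\Phi,\Psi}(\Omega)},\|g\|_{X_{\Phi,\Psi}(\Omega)}^{1/P_\Psi}\right\}\Phi^{-1}\!\left(\int_\Omega\Phi(|\nabla u(x)|)\,dx\right). \]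
   Context: A Young function is $\Phi(t)=\int_0^t\varphi(s)\,ds$ with $\varphi$ increasing, right continuous, $\varphi(t)=0$ iff $t=0$; $\tilde\Phi(t)=\sup_{s>0}\{st-\Phi(s)\}$. $\Delta'$: $\Phi(st)\le C\Phi(s)\Phi(t)$ for all $s,t\ge0$, some $C>1$. $\Phi<<\Psi$ means there is $C>0$ with $\sum_{i=1}^\infty\Psi\circ\Phi^{-1}(a_i)\le C\,\Psi\circ\Phi^{-1}(\sum_{i=1}^\infty a_i)$ for every sequence $a_i\ge0$. $P_\Psi=\inf\{\alpha>0:\Psi'(t)/\Psi(t)\le\alpha/t\ \forall t>0\}$. For an interval $I$ and Young function $A$, $\|f\|_{L^A(I)}=\inf\{\lambda>0:\int_I A(|f|/\lambda)\le1\}$ (Luxemburg norm). With $\zeta(s)=s^{\frac1N-1}$, $\eta_{\Phi,\Psi}(r)=r\,\Psi\big(\|\zeta\|_{L^{\tilde\Phi}((r,|\Omega|))}\big)$ for $r\in(0,|\Omega|)$. For measurable $g$, $g^*(t)=\inf\{s>0:|\{|g|>s\}|<t\}$, $g^{**}(t)=\frac1t\int_0^tg^*$; $\|g\|_{X_{\Phi,\Psi}(\Omega)}=\sup_{0<r<|\Omega|}g^{**}(r)\eta_{\Phi,\Psi}(r)$ and $X_{\Phi,\Psi}(\Omega)=\{g\text{ measurable, a.e. finite}:\|g\|_{X_{\Phi,\Psi}(\Omega)}<\infty\}$. *)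

theory Defs
  imports "HOL-Analysis.Analysis"
begin

definition is_young_density :: "(real \<Rightarrow> real) \<Rightarrow> (real \<Rightarrow> real) \<Rightarrow> bool" where
  "is_young_density \<Phi> \<phi> \<longleftrightarrow>
     mono_on {0..} \<phi> \<and>
     (\<forall>t\<ge>0. continuous (at_right t) \<phi>) \<and>
     (\<forall>t\<ge>0. \<phi> t = 0 \<longleftrightarrow> t = 0) \<and>
     (\<forall>t\<ge>0. \<Phi> t = integral {0..t} \<phi>)"

definition young_function :: "(real \<Rightarrow> real) \<Rightarrow> bool" where
  "young_function \<Phi> \<longleftrightarrow> (\<exists>\<phi>. is_young_density \<Phi> \<phi>)"

text \<open>The (right continuous) density; it is unique on [0,oo) (it is the right derivative).\<close>
definition young_density :: "(real \<Rightarrow> real) \<Rightarrow> real \<Rightarrow> real" where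
  "young_density \<Phi> = (SOME \<phi>. is_young_density \<Phi> \<phi>)"

text \<open>Complementary function (real valued; finiteness is assumed separately where used).\<close>
definition young_conj :: "(real \<Rightarrow> real) \<Rightarrow> real \<Rightarrow> real" where
  "young_conj \<Phi> t = Sup ((\<lambda>s. s * t - \<Phi> s) ` {0<..})"

definition young_inv :: "(real \<Rightarrow> real) \<Rightarrow> real \<Rightarrow> real" where
  "young_inv \<Phi> y = (THE t. 0 \<le> t \<and> \<Phi> t = y)"

definition delta_prime :: "(real \<Rightarrow> real) \<Rightarrow> bool" where
  "delta_prime \<Phi> \<longleftrightarrow> (\<exists>C>1. \<forall>s\<ge>0. \<forall>t\<ge>0. \<Phi> (s * t) \<le> C * \<Phi> s * \<Phi> t)"

text \<open>\<open>\<Phi> << \<Psi>\<close>; the inequality with an infinite right-hand side is trivial, so only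
  summable sequences matter; for those the (nonnegative) left series must converge with the bound.\<close>
definition young_ll :: "(real \<Rightarrow> real) \<Rightarrow> (real \<Rightarrow> real) \<Rightarrow> bool" where
  "young_ll \<Phi> \<Psi> \<longleftrightarrow> (\<exists>C>0. \<forall>a::nat \<Rightarrow> real. (\<forall>i. 0 \<le> a i) \<longrightarrow> summable a \<longrightarrow>
      summable (\<lambda>i. \<Psi> (young_inv \<Phi> (a i))) \<and>
      (\<Sum>i. \<Psi> (young_inv \<Phi> (a i))) \<le> C * \<Psi> (young_inv \<Phi> (\<Sum>i. a i)))"

definition P_index :: "(real \<Rightarrow> real) \<Rightarrow> real" where
  "P_index \<Psi> = Inf {\<alpha>. \<alpha> > 0 \<and> (\<forall>t>0. young_density \<Psi> t / \<Psi> t \<le> \<alpha> / t)}"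

text \<open>Luxemburg norm of \<open>\<zeta>(s) = s^(1/N-1)\<close> in \<open>L^{\<Phi>~}((r,|\<Omega>|))\<close>, valued in [0,oo].\<close>
definition zeta_lux :: "nat \<Rightarrow> (real \<Rightarrow> real) \<Rightarrow> ennreal \<Rightarrow> real \<Rightarrow> ennreal" where
  "zeta_lux N \<Phi> m r = Inf {ennreal l | l. l > 0 \<and>
      (\<integral>\<^sup>+ s \<in> {s. r < s \<and> ennreal s < m}.
          ennreal (young_conj \<Phi> (\<bar>s powr (1 / real N - 1)\<bar> / l)) \<partial>lborel) \<le> 1}"

definition eta :: "nat \<Rightarrow> (real \<Rightarrow> real) \<Rightarrow> (real \<Rightarrow> real) \<Rightarrow> ennreal \<Rightarrow> real \<Rightarrow> ennreal" where
  "eta N \<Phi> \<Psi> m r =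
     (if zeta_lux N \<Phi> m r = top then top else ennreal (r * \<Psi> (enn2real (zeta_lux N \<Phi> m r))))"

definition dec_rearr :: "('a::euclidean_space \<Rightarrow> real) \<Rightarrow> 'a set \<Rightarrow> real \<Rightarrow> ennreal" where
  "dec_rearr g \<Omega> t = Inf {ennreal s | s. s > 0 \<and>
      emeasure lebesgue {x \<in> \<Omega>. \<bar>g x\<bar> > s} < ennreal t}"

definition max_fun :: "('a::euclidean_space \<Rightarrow> real) \<Rightarrow> 'a set \<Rightarrow> real \<Rightarrow> ennreal" where
  "max_fun g \<Omega> t = (\<integral>\<^sup>+ \<tau> \<in> {0<..<t}. dec_rearr g \<Omega> \<tau> \<partial>lborel) / ennreal t"

definition X_norm :: "(real \<Rightarrow> real) \<Rightarrow> (real \<Rightarrow> real) \<Rightarrow> 'a::euclidean_space set \<Rightarrow> ('a \<Rightarrow> real) \<Rightarrow> ennreal" where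
  "X_norm \<Phi> \<Psi> \<Omega> g = (SUP r \<in> {r. 0 < r \<and> ennreal r < emeasure lebesgue \<Omega>}.
      max_fun g \<Omega> r * eta DIM('a) \<Phi> \<Psi> (emeasure lebesgue \<Omega>) r)"

definition X_space :: "(real \<Rightarrow> real) \<Rightarrow> (real \<Rightarrow> real) \<Rightarrow> 'a::euclidean_space set \<Rightarrow> ('a \<Rightarrow> real) set" where
  "X_space \<Phi> \<Psi> \<Omega> = {g. g \<in> borel_measurable (restrict_space lebesgue \<Omega>) \<and> X_norm \<Phi> \<Psi> \<Omega> g < top}"

definition grad :: "('a::euclidean_space \<Rightarrow> real) \<Rightarrow> 'a \<Rightarrow> 'a" where
  "grad u x = (\<Sum>i\<in>Basis. frechet_derivative u (at x) i *\<^sub>R i)"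

definition C1c :: "'a::euclidean_space set \<Rightarrow> ('a \<Rightarrow> real) set" where
  "C1c \<Omega> = {u. (\<forall>x\<in>\<Omega>. u differentiable (at x)) \<and> continuous_on \<Omega> (grad u) \<and>
      compact (closure {x. u x \<noteq> 0}) \<and> closure {x. u x \<noteq> 0} \<subseteq> \<Omega>}"

end

theory Submission
  imports Defs "HOL-Real_Asymp.Real_Asymp"
begin

text \<open>Decompose \<open>\<Omega>\<close> along the dyadic levels \<open>\<theta>\<close> of \<open>|u|\<close>. Truncating \<open>u\<close> between \<open>\<theta>\<close> and \<open>2\<theta>\<close> gives a
  \<open>C\<^sup>1\<close> function bounded by the Riesz potential of its gradient. Averaging this bound over
  \<open>E = {|u| > 2\<theta>}\<close>, \<open>|E| = r\<close>, pairs the gradient with the averaged Riesz kernel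
  of \<open>E\<close>, whose rearrangement on a set disjoint from \<open>E\<close> is at most a multiple of \<open>\<zeta>(r + s)\<close>. Young's
  inequality and \<open>\<Delta>'\<close> for \<open>\<Phi>\<close> and its conjugate turn this into
  \<open>\<theta> \<le> K \<parallel>\<zeta>\<parallel> \<Phi>\<^sup>-\<^sup>1(\<integral> \<Phi>(|\<nabla>u|))\<close>, with the norm of \<open>\<zeta>\<close> taken over \<open>(r, |\<Omega>|)\<close> and the integral over
  \<open>{\<theta> < |u| \<le> 2\<theta>}\<close>; no isoperimetric inequality is needed. Since \<open>\<integral>\<^sub>E |g| \<le> r g\<^sup>*\<^sup>*(r)\<close>, the definition
  of the norm of \<open>g\<close> cancels \<open>\<Psi>(\<parallel>\<zeta>\<parallel>)\<close>, and \<open>\<Phi> << \<Psi>\<close> sums the levels. The power \<open>1/P\<^sub>\<Psi>\<close> comes from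
  \<open>\<Psi>(ct) \<ge> c\<^bsup>P\<^esup> \<Psi>(t)\<close> for \<open>c \<le> 1\<close>.\<close>

subsection \<open>Young functions\<close>

locale young_fun =
  fixes A :: "real \<Rightarrow> real" and a :: "real \<Rightarrow> real"
  assumes density: "is_young_density A a"
begin

lemma density_mono: "0 \<le> s \<Longrightarrow> s \<le> t \<Longrightarrow> a s \<le> a t"
  using density by (auto simp: is_young_density_def mono_on_def)

lemma density_zero: "a 0 = 0"
  using density by (auto simp: is_young_density_def)

lemma density_pos:
  assumes "0 < t"
  shows "0 < a t"
proof -
  have "a t \<noteq> 0" using density assms unfolding is_young_density_def by (metis less_eq_real_def less_irrefl)
  then show ?thesis using density_mono[of 0 t] density_zero assms by simp
qed

lemma density_nonneg: "0 \<le> t \<Longrightarrow> 0 \<le> a t"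
  using density_mono[of 0 t] density_zero by simp

lemma density_integrable: "0 \<le> s \<Longrightarrow> a integrable_on {s..t}"
  by (rule integrable_on_mono_on) (auto simp: mono_on_def intro!: density_mono)

lemma eq_integral: "0 \<le> t \<Longrightarrow> A t = integral {0..t} a"
  using density by (auto simp: is_young_density_def)

lemma at_zero: "A 0 = 0"
  by (simp add: eq_integral)

lemma diff_eq_integral:
  assumes "0 \<le> s" "s \<le> t"
  shows "A t - A s = integral {s..t} a"
  using Henstock_Kurzweil_Integration.integral_combine[of 0 s t a] assms density_integrable[of 0 t]
  by (simp add: eq_integral)

text \<open>Convexity in secant form: on \<open>{s..t}\<close> the monotone density lies between its
  endpoint values.\<close>

lemma diff_bounds:
  assumes "0 \<le> s" "s \<le> t"
  shows "(t - s) * a s \<le> A t - A s" "A t - A s \<le> (t - s) * a t"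
proof -
  have "integral {s..t} (\<lambda>_. a s) \<le> integral {s..t} a"
    using assms by (intro integral_le density_integrable) (auto intro: density_mono)
  moreover have "integral {s..t} a \<le> integral {s..t} (\<lambda>_. a t)"
    using assms by (intro integral_le density_integrable) (auto intro: density_mono)
  ultimately show "(t - s) * a s \<le> A t - A s" "A t - A s \<le> (t - s) * a t"
    using assms by (simp_all add: diff_eq_integral)
qed

lemma mono: "0 \<le> s \<Longrightarrow> s \<le> t \<Longrightarrow> A s \<le> A t"
  using diff_bounds(1)[of s t] density_nonneg[of s] mult_nonneg_nonneg[of "t - s" "a s"] by linarith

lemma pos: "0 < t \<Longrightarrow> 0 < A t"
proof -
  assume t: "0 < t"
  have "0 < (t - t/2) * a (t/2)" using t density_pos[of "t/2"] by simp
  also have "\<dots> \<le> A t - A (t/2)" using t by (intro diff_bounds) auto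
  also have "\<dots> \<le> A t" using mono[of 0 "t/2"] t at_zero by simp
  finally show ?thesis .
qed

lemma nonneg: "0 \<le> t \<Longrightarrow> 0 \<le> A t"
  using mono[of 0 t] at_zero by simp

lemma strict: "0 \<le> s \<Longrightarrow> s < t \<Longrightarrow> A s < A t"
proof -
  assume s: "0 \<le> s" "s < t"
  show ?thesis
  proof (cases "s = 0")
    case True then show ?thesis using s pos at_zero by simp
  next
    case False
    then have "0 < (t - s) * a s" using s density_pos[of s] by simp
    then show ?thesis using diff_bounds(1)[of s t] s by simp
  qed
qed

lemma le_iff: "0 \<le> s \<Longrightarrow> 0 \<le> t \<Longrightarrow> A s \<le> A t \<longleftrightarrow> s \<le> t"
  using mono strict by (metis not_less)

lemma le_times_density: "0 \<le> t \<Longrightarrow> A t \<le> t * a t"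
  using diff_bounds(2)[of 0 t] at_zero by simp

text \<open>Since \<open>A s / s \<le> a s\<close> and \<open>a s\<close> is at most the secant
  slope from \<open>s\<close> to \<open>t\<close>, the quotient \<open>A t / t\<close> increases;
  stated without division.\<close>

lemma ratio_mono:
  assumes "0 < s" "s \<le> t"
  shows "A s * t \<le> A t * s"
proof -
  have "A s * (t - s) \<le> s * a s * (t - s)"
    using assms le_times_density[of s] by (intro mult_right_mono) auto
  also have "\<dots> = s * ((t - s) * a s)" by simp
  also have "\<dots> \<le> s * (A t - A s)"
    using assms by (intro mult_left_mono diff_bounds) auto
  finally show ?thesis by (simp add: algebra_simps)
qed

lemma scale_ge:
  assumes "1 \<le> c" "0 \<le> t"
  shows "c * A t \<le> A (c * t)"
proof (cases "t = 0")
  case False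
  then have "A t * (c * t) \<le> A (c * t) * t" using assms by (intro ratio_mono) auto
  then have "t * (c * A t) \<le> t * A (c * t)" by (simp add: algebra_simps)
  then show ?thesis using False assms by simp
qed (simp add: at_zero)

lemma continuous_on_nonneg: "continuous_on {0..} A"
proof -
  have "continuous_on {0..b} A" for b
  proof -
    have "continuous_on {0..b} (\<lambda>x. integral {0..x} a)"
      by (rule indefinite_integral_continuous_1) (simp add: density_integrable)
    then show ?thesis
      by (rule continuous_on_eq) (simp add: eq_integral)
  qed
  then have "continuous (at x within {0..}) A" if "0 \<le> x" for x
  proof -
    have "continuous (at x within {0..x+1}) A"
      using \<open>\<And>b. continuous_on {0..b} A\<close>[of "x+1"] that
      by (auto simp: continuous_on_eq_continuous_within)
    moreover have "at x within {0..x+1} = at x within {0..}"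
      by (rule at_within_nhd[of x "{..<x+1}"]) auto
    ultimately show ?thesis by simp
  qed
  then show ?thesis by (simp add: continuous_on_eq_continuous_within)
qed

text \<open>Superlinear growth (\<open>scale_ge\<close> at the point 1) puts \<open>A b\<close>
  above \<open>y\<close>; the intermediate value theorem does the rest.\<close>

lemma ex_preimage:
  assumes "0 \<le> y"
  shows "\<exists>t\<ge>0. A t = y"
proof -
  define b where "b = max 1 (y / A 1)"
  have "y \<le> b * A 1" using pos[of 1] by (simp add: b_def field_simps max_def)
  also have "\<dots> \<le> A b" using scale_ge[of b 1] by (simp add: b_def)
  finally have "y \<le> A b" .
  moreover have "continuous_on {0..b} A"
    by (rule continuous_on_subset[OF continuous_on_nonneg]) auto
  ultimately show ?thesis
    using IVT'[of A 0 y b] assms at_zero unfolding b_def by fastforce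
qed

lemma inv_props:
  assumes "0 \<le> y"
  shows inv_nonneg: "0 \<le> young_inv A y" and apply_inv: "A (young_inv A y) = y"
proof -
  obtain t where "0 \<le> t \<and> A t = y" using ex_preimage[OF assms] by blast
  then have "0 \<le> young_inv A y \<and> A (young_inv A y) = y"
    unfolding young_inv_def
    by (rule theI) (use \<open>0 \<le> t \<and> A t = y\<close> strict in \<open>metis less_irrefl not_less_iff_gr_or_eq\<close>)
  then show "0 \<le> young_inv A y" "A (young_inv A y) = y" by auto
qed

lemma inv_le: "0 \<le> y \<Longrightarrow> 0 \<le> t \<Longrightarrow> y \<le> A t \<Longrightarrow> young_inv A y \<le> t"
  using le_iff[of "young_inv A y" t] inv_props[of y] by simp

lemma inv_mono: "0 \<le> x \<Longrightarrow> x \<le> y \<Longrightarrow> young_inv A x \<le> young_inv A y"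
  by (rule inv_le) (auto simp: inv_props)

lemma inv_pos: "0 < y \<Longrightarrow> 0 < young_inv A y"
  using inv_props[of y] at_zero by (metis less_eq_real_def less_irrefl)

end

section \<open>Doubling and the index\<close>

locale young_fun_delta = young_fun +
  fixes C :: real
  assumes C_gt: "1 < C" and delta: "\<And>s t. 0 \<le> s \<Longrightarrow> 0 \<le> t \<Longrightarrow> A (s * t) \<le> C * A s * A t"
begin

text \<open>Keeps the set in the definition of \<open>P_index\<close> nonempty:
  \<open>t * a t\<close> is at most the increment of \<open>A\<close> from \<open>t\<close> to
  \<open>2 * t\<close>, and \<open>delta\<close> with factor 2 controls
  \<open>A (2 * t)\<close>.\<close>

lemma density_le_index:
  assumes "0 < t"
  shows "a t / A t \<le> (C * A 2) / t"
proof -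
  have "t * a t \<le> A (2 * t) - A t" using diff_bounds(1)[of t "2*t"] assms by simp
  also have "\<dots> \<le> A (2 * t)" using nonneg[of t] assms by simp
  also have "\<dots> \<le> C * A 2 * A t" using delta[of 2 t] assms by simp
  finally show ?thesis using pos[OF assms] assms by (simp add: field_simps)
qed

end

text \<open>At fixed \<open>t\<close> the condition on \<open>\<alpha>\<close> is closed, so the
  infimum satisfies it too; it is positive because the quotient at \<open>t = 1\<close> is.\<close>

lemma P_index_bound:
  fixes \<Psi> defines "\<psi> \<equiv> young_density \<Psi>"
  assumes "young_fun_delta \<Psi> \<psi> C"
  shows "0 < P_index \<Psi>" "\<And>t. 0 < t \<Longrightarrow> t * \<psi> t \<le> P_index \<Psi> * \<Psi> t"
proof -
  interpret young_fun_delta \<Psi> \<psi> C by fact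
  define S where "S = {\<alpha>. \<alpha> > 0 \<and> (\<forall>t>0. \<psi> t / \<Psi> t \<le> \<alpha> / t)}"
  have P: "P_index \<Psi> = Inf S" by (simp add: P_index_def S_def \<psi>_def)
  have "C * \<Psi> 2 \<in> S"
    using density_le_index C_gt pos[of 2] by (auto simp: S_def)
  then have ne: "S \<noteq> {}" by auto
  have bound: "t * \<psi> t / \<Psi> t \<le> P_index \<Psi>" if "0 < t" for t
    unfolding P
  proof (rule cInf_greatest[OF ne])
    fix x assume "x \<in> S"
    then have "\<psi> t / \<Psi> t \<le> x / t" using that by (auto simp: S_def)
    then show "t * \<psi> t / \<Psi> t \<le> x" using that by (simp add: field_simps)
  qed
  show "t * \<psi> t \<le> P_index \<Psi> * \<Psi> t" if "0 < t" for t
    using bound[OF that] pos[OF that] by (simp add: field_simps)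
  have "0 < 1 * \<psi> 1 / \<Psi> 1" using density_pos[of 1] pos[of 1] by simp
  then show "0 < P_index \<Psi>" using bound[of 1] by linarith
qed

text \<open>The density \<open>a\<close> is only a one-sided derivative of \<open>A\<close>, so the differential inequality
  \<open>t a(t) \<le> P A(t)\<close> is integrated in \<open>n\<close> multiplicative steps \<open>q = c\<^bsup>1/n\<^esup>\<close> and \<open>n \<rightarrow> \<infinity>\<close>.\<close>
lemma (in young_fun) scale_down:
  assumes P: "0 < P" "\<And>t. 0 < t \<Longrightarrow> t * a t \<le> P * A t"
    and c: "0 < c" "c \<le> 1" and t: "0 \<le> t"
  shows "c powr P * A t \<le> A (c * t)"
proof -
  \<comment> \<open>The secant bound with the slope at the right endpoint \<open>s\<close>, then the
    hypothesis \<open>s * a s \<le> P * A s\<close>.\<close>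
  have step: "(1 - P * (1 - q)) * A s \<le> A (q * s)" if "0 < q" "q \<le> 1" "0 \<le> s" for q s
  proof (cases "s = 0")
    case False
    have "A s - A (q * s) \<le> (s - q * s) * a s"
      using that by (intro diff_bounds) (auto simp: mult_left_le_one_le)
    also have "\<dots> = (1 - q) * (s * a s)" by (simp add: algebra_simps)
    also have "\<dots> \<le> (1 - q) * (P * A s)"
      using that False by (intro mult_left_mono P) auto
    finally show ?thesis by (simp add: algebra_simps)
  qed (simp add: at_zero)
  have iter: "(1 - P * (1 - q)) ^ n * A t \<le> A (q ^ n * t)"
    if "0 < q" "q \<le> 1" "0 \<le> 1 - P * (1 - q)" for q n
  proof (induction n)
    case (Suc n)
    have "(1 - P * (1 - q)) ^ Suc n * A t = (1 - P * (1 - q)) * ((1 - P * (1 - q)) ^ n * A t)"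
      by simp
    also have "\<dots> \<le> (1 - P * (1 - q)) * A (q ^ n * t)"
      using that Suc by (intro mult_left_mono) auto
    also have "\<dots> \<le> A (q * (q ^ n * t))" using that t by (intro step) auto
    finally show ?case by (simp add: mult.assoc)
  qed simp
  define q where "q n = c powr (1 / real n)" for n
  have lim: "(\<lambda>n. (1 - P * (1 - q n)) ^ n) \<longlonglongrightarrow> c powr P"
    unfolding q_def powr_def[of c P] using P(1) c(1) by (simp only: c(1) less_imp_neq[symmetric] if_False, real_asymp)
  \<comment> \<open>As \<open>q n\<close> tends to 1, the factor of a single step becomes positive;
    \<open>iter\<close> needs its sign to multiply inequalities.\<close>
  have "(\<lambda>n. 1 - P * (1 - q n)) \<longlonglongrightarrow> 1"
    unfolding q_def using P(1) c(1) by real_asymp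
  then have "eventually (\<lambda>n. 1 - P * (1 - q n) > 0) sequentially"
    by (rule order_tendstoD) simp
  then have "eventually (\<lambda>n. (1 - P * (1 - q n)) ^ n * A t \<le> A (c * t)) sequentially"
    using eventually_gt_at_top[of 0]
  proof eventually_elim
    case (elim n)
    \<comment> \<open>\<open>n = 0\<close> is excluded because \<open>1 / 0 = 0\<close> would give
      \<open>q 0 ^ 0 = 1\<close>.\<close>
    have "q n ^ n = c" using elim c by (simp add: q_def powr_powr flip: powr_realpow)
    moreover have "0 < q n" "q n \<le> 1" using c by (auto simp: q_def powr_le1)
    ultimately show ?case using iter[of "q n" n] elim by simp
  qed
  moreover have "(\<lambda>n. (1 - P * (1 - q n)) ^ n * A t) \<longlonglongrightarrow> c powr P * A t"
    by (intro tendsto_intros lim)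
  ultimately show ?thesis
    by (intro tendsto_upperbound) auto
qed

section \<open>The complementary function\<close>

context young_fun
begin

text \<open>Boundedness of each set makes the real \<open>Sup\<close> in \<open>young_conj\<close> a
  genuine supremum.\<close>

context
  assumes conj_bdd: "\<And>t. 0 \<le> t \<Longrightarrow> bdd_above ((\<lambda>s. s * t - A s) ` {0<..})"
begin

lemma young_ineq:
  assumes "0 \<le> s" "0 \<le> t"
  shows "s * t \<le> A s + young_conj A t"
proof -
  have *: "s * t - A s \<le> young_conj A t" if "0 < s" "0 \<le> t" for s t
    unfolding young_conj_def by (rule cSup_upper) (use that conj_bdd in auto)
  \<comment> \<open>The supremum runs over \<open>s > 0\<close> only, so its nonnegativity comes
    from \<open>s = 1 / (n + 1)\<close> tending to 0; this also settles the case
    \<open>s = 0\<close> of the claim.\<close>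
  have "0 \<le> young_conj A t"
  proof (rule tendsto_upperbound[of "\<lambda>n. (1 / real (Suc n)) * t - A (1 / real (Suc n))" _ sequentially])
    have "(\<lambda>n. A (1 / real (Suc n))) \<longlonglongrightarrow> A 0"
      by (rule continuous_on_tendsto_compose[OF continuous_on_nonneg])
         (use LIMSEQ_inverse_real_of_nat in \<open>auto simp: inverse_eq_divide\<close>)
    moreover have "(\<lambda>n. (1 / real (Suc n)) * t) \<longlonglongrightarrow> 0 * t"
      by (intro tendsto_intros) (use LIMSEQ_inverse_real_of_nat in \<open>auto simp: inverse_eq_divide\<close>)
    ultimately show "(\<lambda>n. (1 / real (Suc n)) * t - A (1 / real (Suc n))) \<longlonglongrightarrow> 0"
      using tendsto_diff at_zero by fastforce
    show "\<forall>\<^sub>F n in sequentially.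
        (1 / real (Suc n)) * t - A (1 / real (Suc n)) \<le> young_conj A t"
      using assms by (intro always_eventually allI *) auto
  qed simp
  then show ?thesis using *[of s t] assms at_zero by (cases "s = 0") auto
qed

lemma conj_nonneg: "0 \<le> t \<Longrightarrow> 0 \<le> young_conj A t"
  using young_ineq[of 0 t] at_zero by simp

lemma conj_mono:
  assumes "0 \<le> s" "s \<le> t"
  shows "young_conj A s \<le> young_conj A t"
  unfolding young_conj_def[of A s]
proof (rule cSup_least)
  fix x assume "x \<in> (\<lambda>r. r * s - A r) ` {0<..}"
  then obtain r where r: "0 < r" "x = r * s - A r" by auto
  then have "x \<le> r * t - A r" using assms by simp
  then show "x \<le> young_conj A t" using young_ineq[of r t] r assms by linarith
qed auto

text \<open>The line \<open>s * (A x / x)\<close> stays below \<open>A x\<close> for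
  \<open>s \<le> x\<close> and, as \<open>A s / s\<close> increases, below \<open>A s\<close> for
  \<open>s > x\<close>.\<close>

lemma conj_le:
  assumes "0 < x"
  shows "young_conj A (A x / x) \<le> A x"
  unfolding young_conj_def
proof (rule cSup_least)
  fix z assume "z \<in> (\<lambda>s. s * (A x / x) - A s) ` {0<..}"
  then obtain s where s: "0 < s" "z = s * (A x / x) - A s" by auto
  show "z \<le> A x"
  proof (cases "s \<le> x")
    case True
    then have "s * (A x / x) \<le> A x" using assms nonneg[of x] mult_right_mono[of s x "A x"] by (simp add: field_simps)
    then show ?thesis using s nonneg[of s] by simp
  next
    case False
    then have "s * (A x / x) \<le> A s" using assms ratio_mono[of x s] by (simp add: field_simps)
    then show ?thesis using s nonneg[of x] assms by simp
  qed
qed auto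

text \<open>By \<open>conj_le\<close> at \<open>x\<close> and \<open>y\<close>, the
  \<open>\<Delta>'\<close> condition of the conjugate bounds it at \<open>k / (x * y)\<close> by
  \<open>D * k\<close>; Young's inequality against \<open>z\<close>, where
  \<open>A z = D * k\<close>, then bounds \<open>x * y\<close> from below. Serves to exchange a
  scaling factor of the gradient for the inverse of its energy.\<close>

lemma inv_mult_lower:
  assumes D: "1 < D" "\<And>s t. 0 \<le> s \<Longrightarrow> 0 \<le> t \<Longrightarrow> young_conj A (s * t) \<le> D * young_conj A s * young_conj A t"
    and xy: "0 < x" "0 < y" and k: "0 < k" "A x * A y = k"
  shows "young_inv A (D * k) / (2 * D) \<le> x * y"
proof -
  define z where "z = young_inv A (D * k)"
  have z: "0 \<le> z" "A z = D * k" using inv_props[of "D * k"] D k by (auto simp: z_def)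
  have "young_conj A ((A x / x) * (A y / y)) \<le> D * young_conj A (A x / x) * young_conj A (A y / y)"
    using D xy by (intro D) (auto intro!: divide_nonneg_pos nonneg)
  also have "\<dots> = D * (young_conj A (A x / x) * young_conj A (A y / y))" by simp
  also have "\<dots> \<le> D * (A x * A y)"
    using D xy by (intro mult_left_mono mult_mono conj_le nonneg conj_nonneg divide_nonneg_pos) auto
  finally have conj: "young_conj A (k / (x * y)) \<le> D * k"
    using k xy by (simp add: field_simps)
  have "z * (k / (x * y)) \<le> A z + young_conj A (k / (x * y))"
    using z k xy by (intro young_ineq) auto
  also have "\<dots> \<le> 2 * D * k" using conj z by simp
  finally have "z * k \<le> 2 * D * k * (x * y)" using xy by (simp add: field_simps)
  then have "z \<le> 2 * D * (x * y)" using k(1) by (simp add: mult.commute mult.left_commute)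
  then show ?thesis using D by (simp add: z_def field_simps)
qed

end
end

subsection \<open>Layer cake formula and rearrangements\<close>

lemma sigma_finite_lebesgue: "sigma_finite_measure (lebesgue :: 'a::euclidean_space measure)"
proof
  obtain A :: "'a set set" where A: "countable A" "A \<subseteq> sets lborel" "\<Union>A = space lborel"
      "\<forall>a\<in>A. emeasure lborel a \<noteq> \<infinity>"
    using lborel.sigma_finite_countable by blast
  then show "\<exists>A::'a set set. countable A \<and> A \<subseteq> sets lebesgue \<and> \<Union>A = space lebesgue \<and>
      (\<forall>a\<in>A. emeasure lebesgue a \<noteq> \<infinity>)"
    by (intro exI[of _ A]) (auto simp: sets_completionI_sets)
qed

lemma emeasure_lborel_ennreal_Ioo:
  "emeasure lborel {l::real. 0 < l \<and> ennreal l < c} = c"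
proof (cases "c = top")
  case True
  then have "{l::real. 0 < l \<and> ennreal l < c} = {0<..}" by (auto simp: less_top)
  moreover have "emeasure lborel ({0<..}::real set) = top"
  proof (rule ccontr)
    assume "emeasure lborel ({0<..}::real set) \<noteq> top"
    then obtain n :: nat where n: "emeasure lborel ({0<..}::real set) < of_nat n"
      using ennreal_Ex_less_of_nat[of "emeasure lborel ({0<..}::real set)"] by (auto simp: less_top)
    have "of_nat n = emeasure lborel {0<..<real n}" by (simp add: ennreal_of_nat_eq_real_of_nat)
    also have "\<dots> \<le> emeasure lborel ({0<..}::real set)" by (rule emeasure_mono) auto
    finally show False using n by simp
  qed
  ultimately show ?thesis using True by simp
next
  case False
  then obtain r where r: "c = ennreal r" "0 \<le> r" by (cases c) auto
  then have "{l::real. 0 < l \<and> ennreal l < c} = {0<..<r}"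
    by (auto simp: ennreal_less_iff)
  then show ?thesis using r by simp
qed

lemma emeasure_lborel_ennreal_Ioc:
  "emeasure lborel {l::real. 0 < l \<and> ennreal l \<le> c} = c"
proof (cases "c = top")
  case True
  then show ?thesis using emeasure_lborel_ennreal_Ioo[of top] by (simp add: less_top[symmetric])
next
  case False
  then obtain r where r: "c = ennreal r" "0 \<le> r" by (cases c) auto
  then have "{l::real. 0 < l \<and> ennreal l \<le> c} = {0<..r}"
    by auto
  then show ?thesis using r by simp
qed

text \<open>Tonelli on the region under the graph: \<open>f x\<close> is the length of the set of
  \<open>l > 0\<close> below it.\<close>

lemma nn_integral_layer_cake_less:
  fixes f :: "'a \<Rightarrow> ennreal"
  assumes "sigma_finite_measure M" and [measurable]: "f \<in> borel_measurable M"
  shows "(\<integral>\<^sup>+x. f x \<partial>M) = (\<integral>\<^sup>+l\<in>{0<..}. emeasure M {x\<in>space M. ennreal l < f x} \<partial>lborel)"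
proof -
  interpret sigma_finite_measure M by fact
  interpret pair_sigma_finite M lborel ..
  have "(\<integral>\<^sup>+x. f x \<partial>M) = (\<integral>\<^sup>+x. (\<integral>\<^sup>+l. indicator {l. 0 < l \<and> ennreal l < f x} l \<partial>lborel) \<partial>M)"
    by (simp add: emeasure_lborel_ennreal_Ioo)
  also have "\<dots> = (\<integral>\<^sup>+l. (\<integral>\<^sup>+x. indicator {l. 0 < l \<and> ennreal l < f x} l \<partial>M) \<partial>lborel)"
    by (rule Fubini'[of "\<lambda>x l. indicator {l. 0 < l \<and> ennreal l < f x} l", symmetric])
      (unfold indicator_def mem_Collect_eq, measurable)
  also have "\<dots> = (\<integral>\<^sup>+l. (\<integral>\<^sup>+x. indicator {x\<in>space M. ennreal l < f x} x * indicator {0<..} l \<partial>M) \<partial>lborel)"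
    by (intro nn_integral_cong) (auto split: split_indicator)
  also have "\<dots> = (\<integral>\<^sup>+l\<in>{0<..}. emeasure M {x\<in>space M. ennreal l < f x} \<partial>lborel)"
    by (simp add: nn_integral_multc)
  finally show ?thesis .
qed

lemma nn_integral_layer_cake_le:
  fixes f :: "'a \<Rightarrow> ennreal"
  assumes "sigma_finite_measure M" and [measurable]: "f \<in> borel_measurable M"
  shows "(\<integral>\<^sup>+x. f x \<partial>M) = (\<integral>\<^sup>+l\<in>{0<..}. emeasure M {x\<in>space M. ennreal l \<le> f x} \<partial>lborel)"
proof -
  interpret sigma_finite_measure M by fact
  interpret pair_sigma_finite M lborel ..
  have "(\<integral>\<^sup>+x. f x \<partial>M) = (\<integral>\<^sup>+x. (\<integral>\<^sup>+l. indicator {l. 0 < l \<and> ennreal l \<le> f x} l \<partial>lborel) \<partial>M)"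
    by (simp add: emeasure_lborel_ennreal_Ioc)
  also have "\<dots> = (\<integral>\<^sup>+l. (\<integral>\<^sup>+x. indicator {l. 0 < l \<and> ennreal l \<le> f x} l \<partial>M) \<partial>lborel)"
    by (rule Fubini'[of "\<lambda>x l. indicator {l. 0 < l \<and> ennreal l \<le> f x} l", symmetric])
      (unfold indicator_def mem_Collect_eq, measurable)
  also have "\<dots> = (\<integral>\<^sup>+l. (\<integral>\<^sup>+x. indicator {x\<in>space M. ennreal l \<le> f x} x * indicator {0<..} l \<partial>M) \<partial>lborel)"
    by (intro nn_integral_cong) (auto split: split_indicator)
  also have "\<dots> = (\<integral>\<^sup>+l\<in>{0<..}. emeasure M {x\<in>space M. ennreal l \<le> f x} \<partial>lborel)"
    by (simp add: nn_integral_multc)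
  finally show ?thesis .
qed

text \<open>One layer cake formula uses \<open><\<close> and the other \<open>\<le>\<close>, so
  strict superlevel sets need only be bounded by non-strict ones; this tolerates the endpoints of
  rearrangements.\<close>

lemma nn_integral_le_of_superlevel_le:
  fixes f :: "'a \<Rightarrow> ennreal" and h :: "'b \<Rightarrow> ennreal"
  assumes "sigma_finite_measure M" "sigma_finite_measure N"
    and "f \<in> borel_measurable M" "h \<in> borel_measurable N"
    and le: "\<And>l. 0 < l \<Longrightarrow> emeasure M {x\<in>space M. ennreal l < f x} \<le> emeasure N {x\<in>space N. ennreal l \<le> h x}"
  shows "(\<integral>\<^sup>+x. f x \<partial>M) \<le> (\<integral>\<^sup>+x. h x \<partial>N)"
  unfolding nn_integral_layer_cake_less[OF assms(1,3)] nn_integral_layer_cake_le[OF assms(2,4)]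
  by (intro nn_integral_mono) (auto split: split_indicator intro: le)

text \<open>Superlevel sets of a decreasing function are half-lines \<open>{..<b}\<close>, with or
  without the endpoint \<open>b\<close>, or empty or everything.\<close>

lemma borel_measurable_antimono_ennreal:
  fixes f :: "real \<Rightarrow> ennreal"
  assumes "antimono f"
  shows "f \<in> borel_measurable borel"
proof (rule borel_measurableI_greater)
  fix y
  have "{x. y < f x} \<in> sets borel"
  proof (cases "bdd_above {x. y < f x} \<and> {x. y < f x} \<noteq> {}")
    case True
    define b where "b = Sup {x. y < f x}"
    have "y < f x" if "x < b" for x
    proof -
      have "\<exists>z\<in>{x. y < f x}. x < z"
        using that True less_cSup_iff[of "{x. y < f x}" x] unfolding b_def by simp
      then obtain z where "y < f z" "x < z" by blast
      then show ?thesis using assms by (auto simp: antimono_def intro: less_le_trans[of y "f z"])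
    qed
    moreover have "x \<le> b" if "y < f x" for x
      using True that by (auto simp: b_def intro: cSup_upper)
    ultimately have sub: "{..<b} \<subseteq> {x. y < f x}" "{x. y < f x} \<subseteq> {..b}" by auto
    have "{x. y < f x} = {..<b} \<union> {x. y < f x} \<inter> {b}"
    proof (intro subset_antisym subsetI)
      fix x assume "x \<in> {x. y < f x}"
      then show "x \<in> {..<b} \<union> {x. y < f x} \<inter> {b}" using sub(2) by (cases "x = b") auto
    next
      fix x assume "x \<in> {..<b} \<union> {x. y < f x} \<inter> {b}"
      then show "x \<in> {x. y < f x}" using sub(1) by blast
    qed
    also have "\<dots> \<in> sets borel" by (intro sets.Un borel_open borel_closed finite_imp_closed) auto
    finally show ?thesis .
  next
    case False
    then consider "{x. y < f x} = {}" | "\<not> bdd_above {x. y < f x}" by blast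
    then show ?thesis
    proof cases
      case 2
      have "y < f x" for x
      proof -
        obtain z where "y < f z" "x < z" using 2 by (auto simp: bdd_above_def not_le)
        then show ?thesis using assms by (auto simp: antimono_def intro: less_le_trans[of y "f z"])
      qed
      then have "{x. y < f x} = UNIV" by auto
      then show ?thesis by simp
    qed simp
  qed
  then show "{x \<in> space borel. y < f x} \<in> sets borel" by simp
qed

lemma antimono_dec_rearr: "antimono (dec_rearr g \<Omega>)"
  unfolding antimono_def dec_rearr_def
  by (auto intro!: Inf_superset_mono intro: less_le_trans ennreal_leI)

lemma borel_measurable_dec_rearr [measurable]: "dec_rearr g \<Omega> \<in> borel_measurable borel"
  by (rule borel_measurable_antimono_ennreal[OF antimono_dec_rearr])

text \<open>An admissible \<open>s < l\<close> would have a superlevel set of measure at least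
  \<open>t\<close>. The strict \<open><\<close> in \<open>dec_rearr\<close> is what allows equality
  in the hypothesis on \<open>t\<close>.\<close>

lemma le_dec_rearr:
  assumes "open \<Omega>" and g: "g \<in> borel_measurable (restrict_space lebesgue \<Omega>)"
    and "0 < l" and t: "ennreal t \<le> emeasure lebesgue {x \<in> \<Omega>. l < \<bar>g x\<bar>}"
  shows "ennreal l \<le> dec_rearr g \<Omega> t"
  unfolding dec_rearr_def
proof (rule Inf_greatest, clarify)
  fix s :: real assume s: "0 < s" "emeasure lebesgue {x \<in> \<Omega>. s < \<bar>g x\<bar>} < ennreal t"
  have "{x \<in> \<Omega>. s < \<bar>g x\<bar>} \<in> sets (restrict_space lebesgue \<Omega>)"
    using borel_measurable_abs[OF g] borel_measurable_less[of "\<lambda>_. s" "restrict_space lebesgue \<Omega>" "\<lambda>x. \<bar>g x\<bar>"]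
    by (simp add: space_restrict_space)
  then have *: "{x \<in> \<Omega>. s < \<bar>g x\<bar>} \<in> sets lebesgue"
    using \<open>open \<Omega>\<close> by (subst (asm) sets_restrict_space_iff) (auto simp: space_restrict_space)
  show "ennreal l \<le> ennreal s"
  proof (rule ccontr)
    assume "\<not> ennreal l \<le> ennreal s"
    then have "s < l" using s(1) by (auto simp: ennreal_le_iff not_le)
    then have "emeasure lebesgue {x \<in> \<Omega>. l < \<bar>g x\<bar>} \<le> emeasure lebesgue {x \<in> \<Omega>. s < \<bar>g x\<bar>}"
      by (intro emeasure_mono *) auto
    then show False using s t by (meson leD le_less_trans order_trans)
  qed
qed

text \<open>\<open>g\<close> is measurable on \<open>\<Omega>\<close> only, hence the detour through
  its cut-off to \<open>\<Omega>\<close>.\<close>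

lemma borel_measurable_abs_indicator:
  fixes g :: "'a::euclidean_space \<Rightarrow> real"
  assumes "\<Omega> \<in> sets lebesgue" and "g \<in> borel_measurable (restrict_space lebesgue \<Omega>)"
    and "E \<in> sets lebesgue" "E \<subseteq> \<Omega>"
  shows "(\<lambda>x. ennreal \<bar>g x\<bar> * indicator E x) \<in> borel_measurable lebesgue"
proof -
  have "(\<lambda>x. ennreal \<bar>g x\<bar>) \<in> borel_measurable (restrict_space lebesgue \<Omega>)"
    using assms(2) by measurable
  then have m: "(\<lambda>x. ennreal \<bar>g x\<bar> * indicator \<Omega> x) \<in> borel_measurable lebesgue"
    using assms(1) by (subst (asm) borel_measurable_restrict_space_iff_ennreal) auto
  have "(\<lambda>x. ennreal \<bar>g x\<bar> * indicator \<Omega> x * indicator E x) \<in> borel_measurable lebesgue"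
    by (intro borel_measurable_times_ennreal m borel_measurable_indicator assms)
  also have "(\<lambda>x. ennreal \<bar>g x\<bar> * indicator \<Omega> x * indicator E x) = (\<lambda>x. ennreal \<bar>g x\<bar> * indicator E x)"
    using assms(4) by (auto simp: fun_eq_iff split: split_indicator)
  finally show ?thesis .
qed

text \<open>Hardy-Littlewood for an indicator: the part of \<open>E\<close> where
  \<open>|g| > l\<close> has measure \<open>m \<le> r\<close>, and the rearrangement is at least
  \<open>l\<close> on \<open>(0, m)\<close>, so superlevel sets compare. The factor \<open>r\<close>
  cancels the average in \<open>max_fun\<close>.\<close>

lemma nn_integral_le_max_fun:
  fixes g :: "'a::euclidean_space \<Rightarrow> real"
  assumes "open \<Omega>" and g: "g \<in> borel_measurable (restrict_space lebesgue \<Omega>)"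
    and E: "E \<in> sets lebesgue" "E \<subseteq> \<Omega>" "emeasure lebesgue E = ennreal r" "0 < r"
  shows "(\<integral>\<^sup>+x\<in>E. ennreal \<bar>g x\<bar> \<partial>lebesgue) \<le> ennreal r * max_fun g \<Omega> r"
proof -
  have \<Omega>: "\<Omega> \<in> sets lebesgue" using \<open>open \<Omega>\<close> by auto
  have [measurable]: "(\<lambda>x. ennreal \<bar>g x\<bar> * indicator E x) \<in> borel_measurable lebesgue"
    by (rule borel_measurable_abs_indicator) (use g E \<Omega> in auto)
  have "(\<integral>\<^sup>+x\<in>E. ennreal \<bar>g x\<bar> \<partial>lebesgue) \<le> (\<integral>\<^sup>+ \<tau> \<in> {0<..<r}. dec_rearr g \<Omega> \<tau> \<partial>lborel)"
  proof (rule nn_integral_le_of_superlevel_le)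
    fix l :: real assume l: "0 < l"
    define \<mu> where "\<mu> = emeasure lebesgue {x \<in> E. l < \<bar>g x\<bar>}"
    have set_eq: "{x \<in> space lebesgue. ennreal l < ennreal \<bar>g x\<bar> * indicator E x} = {x \<in> E. l < \<bar>g x\<bar>}"
      using l by (auto simp: ennreal_less_iff split: split_indicator_asm)
    have "\<mu> \<le> ennreal r" unfolding \<mu>_def E(3)[symmetric] by (rule emeasure_mono) (use E in auto)
    then obtain m where m: "\<mu> = ennreal m" "0 \<le> m" "m \<le> r"
      using E(4) by (cases \<mu>) (auto simp: ennreal_le_iff top_unique)
    have "\<mu> \<le> emeasure lebesgue {x \<in> \<Omega>. l < \<bar>g x\<bar>}"
      unfolding \<mu>_def
    proof (rule emeasure_mono)
      have "{x \<in> \<Omega>. l < \<bar>g x\<bar>} \<in> sets (restrict_space lebesgue \<Omega>)"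
        using borel_measurable_abs[OF g] borel_measurable_less[of "\<lambda>_. l" "restrict_space lebesgue \<Omega>" "\<lambda>x. \<bar>g x\<bar>"]
    by (simp add: space_restrict_space)
      then show "{x \<in> \<Omega>. l < \<bar>g x\<bar>} \<in> sets lebesgue"
        using \<Omega> by (subst (asm) sets_restrict_space_iff) (auto simp: space_restrict_space)
    qed (use E in auto)
    then have *: "ennreal l \<le> dec_rearr g \<Omega> t" if "t \<le> m" for t
      using m that by (intro le_dec_rearr assms l) (auto intro: order_trans[OF ennreal_leI])
    have "\<mu> = emeasure lborel {0<..<m}" using m by simp
    also have "\<dots> \<le> emeasure lborel {x \<in> space lborel. ennreal l \<le> dec_rearr g \<Omega> x * indicator {0<..<r} x}"
      by (rule emeasure_mono) (use m * in \<open>auto split: split_indicator\<close>)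
    finally show "emeasure lebesgue {x \<in> space lebesgue. ennreal l < ennreal \<bar>g x\<bar> * indicator E x}
        \<le> emeasure lborel {x \<in> space lborel. ennreal l \<le> dec_rearr g \<Omega> x * indicator {0<..<r} x}"
      unfolding set_eq \<mu>_def .
  qed (measurable, simp_all add: sigma_finite_lebesgue lborel.sigma_finite_measure_axioms)
  also have "\<dots> = ennreal r * max_fun g \<Omega> r"
    unfolding max_fun_def using E(4)
    by (simp add: ennreal_times_divide mult.commute[of "ennreal r"] ennreal_mult_divide_eq)
  finally show ?thesis .
qed

subsection \<open>Riesz potentials\<close>

lemma nn_integral_lborel_scale:
  fixes x :: "'a::euclidean_space"
  assumes "0 < t" and [measurable]: "h \<in> borel_measurable borel"
  shows "(\<integral>\<^sup>+z. h (x + t *\<^sub>R z) \<partial>lborel) = ennreal (t powr - real DIM('a)) * (\<integral>\<^sup>+y. h y \<partial>lborel)"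
proof -
  have "(\<integral>\<^sup>+y. h y \<partial>lborel) =
      (\<integral>\<^sup>+y. h y \<partial>density (distr lborel borel (\<lambda>z. x + t *\<^sub>R z)) (\<lambda>_. \<bar>t\<bar>^DIM('a)))"
    using lborel_affine[of t x] assms by simp
  also have "\<dots> = ennreal (t ^ DIM('a)) * (\<integral>\<^sup>+z. h (x + t *\<^sub>R z) \<partial>lborel)"
    using assms by (simp add: nn_integral_density nn_integral_distr nn_integral_cmult ennreal_power)
  finally have "ennreal (t powr - real DIM('a)) * (\<integral>\<^sup>+y. h y \<partial>lborel) =
      ennreal (t powr - real DIM('a) * t ^ DIM('a)) * (\<integral>\<^sup>+z. h (x + t *\<^sub>R z) \<partial>lborel)"
    using assms by (simp add: ennreal_mult' mult.assoc)
  moreover have "t powr - real DIM('a) * t ^ DIM('a) = 1"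
    using assms by (simp add: powr_minus powr_realpow)
  ultimately show ?thesis by simp
qed

text \<open>Fundamental theorem of calculus along the ray from \<open>x\<close> in direction
  \<open>z\<close>. Directions fill the unit ball instead of the sphere, so that the later average
  over \<open>z\<close> is a Lebesgue integral without polar coordinates;
  \<open>norm z \<le> 1\<close> absorbs the speed.\<close>

lemma abs_le_line_integral_norm_grad:
  fixes v :: "'a::euclidean_space \<Rightarrow> real" and G :: "'a \<Rightarrow> 'a"
  assumes der: "\<And>y. (v has_derivative (\<lambda>h. G y \<bullet> h)) (at y)"
    and cont: "continuous_on UNIV G" and supp: "\<And>y. R \<le> norm y \<Longrightarrow> v y = 0"
    and z: "z \<noteq> 0" "norm z \<le> 1"
  shows "ennreal \<bar>v x\<bar> \<le> (\<integral>\<^sup>+t\<in>{0<..}. ennreal (norm (G (x + t *\<^sub>R z))) \<partial>lborel)"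
proof -
  \<comment> \<open>At time \<open>T\<close> the ray has moved by \<open>|R| + norm x\<close>, hence
    is at distance at least \<open>R\<close> from the origin.\<close>
  define T where "T = (\<bar>R\<bar> + norm x) / norm z"
  have T: "0 \<le> T" by (simp add: T_def)
  have "norm (T *\<^sub>R z) - norm x \<le> norm (x + T *\<^sub>R z)"
    by (metis add.commute norm_diff_ineq)
  moreover have "norm (T *\<^sub>R z) = \<bar>R\<bar> + norm x" using z T by (simp add: T_def)
  ultimately have vT: "v (x + T *\<^sub>R z) = 0" by (intro supp) simp
  define f where "f t = G (x + t *\<^sub>R z) \<bullet> z" for t
  have contf: "continuous_on UNIV f"
    unfolding f_def
    by (intro continuous_on_inner continuous_on_compose2[OF cont, of UNIV "\<lambda>t. x + t *\<^sub>R z"])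
       (auto intro!: continuous_intros)
  have "((\<lambda>t. v (x + t *\<^sub>R z)) has_derivative (\<lambda>h. G (x + t *\<^sub>R z) \<bullet> (h *\<^sub>R z))) (at t)" for t
    by (rule has_derivative_compose[OF _ der]) (auto intro!: derivative_eq_intros)
  then have "DERIV (\<lambda>t. v (x + t *\<^sub>R z)) t :> f t" for t
    unfolding has_field_derivative_def f_def inner_scaleR_right mult.commute[of "G _ \<bullet> z"] .
  then have "has_bochner_integral lborel (\<lambda>t. f t * indicator {0..T} t) (v (x + T *\<^sub>R z) - v (x + 0 *\<^sub>R z))"
    using contf T by (intro has_bochner_integral_FTC_Icc_real) (auto simp: continuous_on_eq_continuous_at)
  from has_bochner_integral_norm_bound[OF this]
  have "ennreal \<bar>v x\<bar> \<le> (\<integral>\<^sup>+t. norm (f t * indicator {0..T} t) \<partial>lborel)"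
    using vT by simp
  also have "\<dots> \<le> (\<integral>\<^sup>+t\<in>{0<..}. ennreal (norm (G (x + t *\<^sub>R z))) \<partial>lborel)"
  proof (rule nn_integral_mono_AE)
    have "AE t in lborel. t \<noteq> (0::real)" by (rule AE_lborel_singleton)
    then show "AE t in lborel. ennreal (norm (f t * indicator {0..T} t))
        \<le> ennreal (norm (G (x + t *\<^sub>R z))) * indicator {0<..} t"
    proof eventually_elim
      case (elim t)
      have "\<bar>f t\<bar> \<le> norm (G (x + t *\<^sub>R z)) * norm z"
        unfolding f_def by (rule Cauchy_Schwarz_ineq2)
      also have "\<dots> \<le> norm (G (x + t *\<^sub>R z))" using z by (simp add: mult_left_le)
      finally show ?case using elim by (auto simp: abs_mult split: split_indicator intro!: ennreal_leI)
    qed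
  qed
  finally show ?thesis .
qed

text \<open>Up to the factor \<open>1/(n-1)\<close> this is the Riesz kernel \<open>d \<mapsto> d\<^sup>1\<^sup>-\<^sup>n\<close>; the integral form makes
  every estimate below an application of Tonelli's theorem.\<close>

definition riesz_kernel :: "nat \<Rightarrow> real \<Rightarrow> ennreal" where
  "riesz_kernel n d = (\<integral>\<^sup>+t. ennreal (t powr - real n) * indicator {t. 0 < t \<and> d < t} t \<partial>lborel)"

lemma borel_measurable_riesz_kernel [measurable]: "riesz_kernel n \<in> borel_measurable borel"
  unfolding riesz_kernel_def[abs_def]
  by (rule borel_measurable_antimono_ennreal)
     (auto simp: antimono_def intro!: nn_integral_mono split: split_indicator)

definition riesz_potential :: "'a::euclidean_space set \<Rightarrow> 'a \<Rightarrow> ennreal" where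
  "riesz_potential E y = (\<integral>\<^sup>+x\<in>E. riesz_kernel DIM('a) (dist x y) \<partial>lborel)"

lemma borel_measurable_riesz_potential [measurable]:
  assumes [measurable]: "E \<in> sets borel"
  shows "riesz_potential E \<in> borel_measurable borel"
  unfolding riesz_potential_def[abs_def] by measurable

text \<open>Integrate the ray bound over \<open>z\<close> in the unit ball. For fixed
  \<open>t\<close>, substituting \<open>y = x + t * z\<close> produces the weight
  \<open>t powr -n\<close> on \<open>ball x t\<close>; integrating out \<open>t\<close> leaves the
  kernel.\<close>

lemma abs_le_riesz_integral_grad:
  fixes v :: "'a::euclidean_space \<Rightarrow> real" and G :: "'a \<Rightarrow> 'a"
  assumes der: "\<And>y. (v has_derivative (\<lambda>h. G y \<bullet> h)) (at y)"
    and cont: "continuous_on UNIV G" and supp: "\<And>y. R \<le> norm y \<Longrightarrow> v y = 0"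
  shows "ennreal \<bar>v x\<bar> * emeasure lborel (ball (0::'a) 1)
    \<le> (\<integral>\<^sup>+y. ennreal (norm (G y)) * riesz_kernel DIM('a) (dist x y) \<partial>lborel)"
proof -
  have [measurable]: "G \<in> borel_measurable borel" "ball c \<rho> \<in> sets borel" for c :: 'a and \<rho>
    using cont by (auto intro: borel_measurable_continuous_onI)
  have "ennreal \<bar>v x\<bar> * emeasure lborel (ball (0::'a) 1) =
      (\<integral>\<^sup>+z. ennreal \<bar>v x\<bar> * indicator (ball (0::'a) 1) z \<partial>lborel)"
    by (subst nn_integral_cmult_indicator) auto
  also have "\<dots> \<le> (\<integral>\<^sup>+z. (\<integral>\<^sup>+t. ennreal (norm (G (x + t *\<^sub>R z))) * indicator {0<..} t * indicator (ball 0 1) z \<partial>lborel) \<partial>lborel)"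
  proof (rule nn_integral_mono_AE)
    have "AE z in lborel. z \<noteq> (0::'a)" by (rule AE_lborel_singleton)
    then show "AE z in lborel. ennreal \<bar>v x\<bar> * indicator (ball (0::'a) 1) z \<le>
        (\<integral>\<^sup>+t. ennreal (norm (G (x + t *\<^sub>R z))) * indicator {0<..} t * indicator (ball 0 1) z \<partial>lborel)"
    proof eventually_elim
      case (elim z)
      then show ?case
        using abs_le_line_integral_norm_grad[OF der cont supp, where z = z and x = x]
        by (auto split: split_indicator)
    qed
  qed
  also have "\<dots> = (\<integral>\<^sup>+t. (\<integral>\<^sup>+z. ennreal (norm (G (x + t *\<^sub>R z))) * indicator {0<..} t * indicator (ball 0 1) z \<partial>lborel) \<partial>lborel)"
    by (rule lborel_pair.Fubini'[symmetric]) measurable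
  also have "\<dots> = (\<integral>\<^sup>+t. (\<integral>\<^sup>+y. ennreal (norm (G y)) * (ennreal (t powr - real DIM('a)) * indicator {t. 0 < t \<and> dist x y < t} t) \<partial>lborel) \<partial>lborel)"
  proof (rule nn_integral_cong)
    fix t :: real
    show "(\<integral>\<^sup>+z. ennreal (norm (G (x + t *\<^sub>R z))) * indicator {0<..} t * indicator (ball 0 1) z \<partial>lborel)
      = (\<integral>\<^sup>+y. ennreal (norm (G y)) * (ennreal (t powr - real DIM('a)) * indicator {t. 0 < t \<and> dist x y < t} t) \<partial>lborel)"
    proof (cases "0 < t")
      case True
      have "(\<integral>\<^sup>+z. ennreal (norm (G (x + t *\<^sub>R z))) * indicator {0<..} t * indicator (ball 0 1) z \<partial>lborel)
        = (\<integral>\<^sup>+z. ennreal (norm (G (x + t *\<^sub>R z))) * indicator (ball x t) (x + t *\<^sub>R z) \<partial>lborel)"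
        using True by (intro nn_integral_cong) (auto simp: dist_norm split: split_indicator)
      also have "\<dots> = ennreal (t powr - real DIM('a)) * (\<integral>\<^sup>+y. ennreal (norm (G y)) * indicator (ball x t) y \<partial>lborel)"
        using True by (intro nn_integral_lborel_scale) auto
      also have "\<dots> = (\<integral>\<^sup>+y. ennreal (t powr - real DIM('a)) * (ennreal (norm (G y)) * indicator (ball x t) y) \<partial>lborel)"
        by (simp add: nn_integral_cmult)
      also have "\<dots> = (\<integral>\<^sup>+y. ennreal (norm (G y)) * (ennreal (t powr - real DIM('a)) * indicator {t. 0 < t \<and> dist x y < t} t) \<partial>lborel)"
        using True by (intro nn_integral_cong) (auto split: split_indicator simp: mult.commute)
      finally show ?thesis .
    qed simp
  qed
  also have "\<dots> = (\<integral>\<^sup>+y. (\<integral>\<^sup>+t. ennreal (norm (G y)) * (ennreal (t powr - real DIM('a)) * indicator {t. 0 < t \<and> dist x y < t} t) \<partial>lborel) \<partial>lborel)"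
    by (rule lborel_pair.Fubini'[symmetric]) (unfold indicator_def mem_Collect_eq, measurable)
  also have "\<dots> = (\<integral>\<^sup>+y. ennreal (norm (G y)) * riesz_kernel DIM('a) (dist x y) \<partial>lborel)"
    unfolding riesz_kernel_def by (intro nn_integral_cong nn_integral_cmult) measurable
  finally show ?thesis .
qed

text \<open>Integrate the pointwise bound over \<open>E\<close> and exchange the integrals: the
  kernel integrates to the potential of \<open>E\<close>, paired with the gradient.\<close>

lemma emeasure_le_integral_grad_riesz_potential:
  fixes v :: "'a::euclidean_space \<Rightarrow> real" and G :: "'a \<Rightarrow> 'a"
  assumes der: "\<And>y. (v has_derivative (\<lambda>h. G y \<bullet> h)) (at y)"
    and cont: "continuous_on UNIV G" and supp: "\<And>y. R \<le> norm y \<Longrightarrow> v y = 0"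
    and [measurable]: "E \<in> sets borel" and ge: "\<And>x. x \<in> E \<Longrightarrow> 1 \<le> \<bar>v x\<bar>"
  shows "emeasure lborel E * emeasure lborel (ball (0::'a) 1)
    \<le> (\<integral>\<^sup>+y. ennreal (norm (G y)) * riesz_potential E y \<partial>lborel)"
proof -
  have [measurable]: "G \<in> borel_measurable borel"
    using cont by (rule borel_measurable_continuous_onI)
  have "emeasure lborel E * emeasure lborel (ball (0::'a) 1) =
      (\<integral>\<^sup>+x. emeasure lborel (ball (0::'a) 1) * indicator E x \<partial>lborel)"
    by (subst nn_integral_cmult_indicator) (auto simp: mult.commute)
  also have "\<dots> \<le> (\<integral>\<^sup>+x. (\<integral>\<^sup>+y. ennreal (norm (G y)) * (riesz_kernel DIM('a) (dist x y) * indicator E x) \<partial>lborel) \<partial>lborel)"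
  proof (rule nn_integral_mono)
    fix x
    show "emeasure lborel (ball (0::'a) 1) * indicator E x \<le>
      (\<integral>\<^sup>+y. ennreal (norm (G y)) * (riesz_kernel DIM('a) (dist x y) * indicator E x) \<partial>lborel)"
    proof (cases "x \<in> E")
      case True
      have "1 * emeasure lborel (ball (0::'a) 1) \<le> ennreal \<bar>v x\<bar> * emeasure lborel (ball (0::'a) 1)"
        using ge[OF True] by (intro mult_right_mono) auto
      also note abs_le_riesz_integral_grad[OF der cont supp]
      finally show ?thesis using True by simp
    qed simp
  qed
  also have "\<dots> = (\<integral>\<^sup>+y. (\<integral>\<^sup>+x. ennreal (norm (G y)) * (riesz_kernel DIM('a) (dist x y) * indicator E x) \<partial>lborel) \<partial>lborel)"
    by (rule lborel_pair.Fubini'[symmetric]) measurable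
  also have "\<dots> = (\<integral>\<^sup>+y. ennreal (norm (G y)) * riesz_potential E y \<partial>lborel)"
    unfolding riesz_potential_def by (intro nn_integral_cong nn_integral_cmult) measurable
  finally show ?thesis .
qed

text \<open>The kernel is symmetric; this lets the larger of two sets carry the potential.\<close>

lemma riesz_potential_symmetric:
  fixes E F :: "'a::euclidean_space set"
  assumes [measurable]: "E \<in> sets borel" "F \<in> sets borel"
  shows "(\<integral>\<^sup>+y\<in>F. riesz_potential E y \<partial>lborel) = (\<integral>\<^sup>+x\<in>E. riesz_potential F x \<partial>lborel)"
proof -
  have "(\<integral>\<^sup>+y\<in>F. riesz_potential E y \<partial>lborel) =
      (\<integral>\<^sup>+y. (\<integral>\<^sup>+x. riesz_kernel DIM('a) (dist x y) * indicator E x * indicator F y \<partial>lborel) \<partial>lborel)"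
    unfolding riesz_potential_def by (intro nn_integral_cong nn_integral_multc[symmetric]) measurable
  also have "\<dots> = (\<integral>\<^sup>+x. (\<integral>\<^sup>+y. riesz_kernel DIM('a) (dist x y) * indicator E x * indicator F y \<partial>lborel) \<partial>lborel)"
    by (rule lborel_pair.Fubini') measurable
  also have "\<dots> = (\<integral>\<^sup>+x. (\<integral>\<^sup>+y. riesz_kernel DIM('a) (dist y x) * indicator F y * indicator E x \<partial>lborel) \<partial>lborel)"
    by (simp add: dist_commute mult.commute mult.left_commute)
  also have "\<dots> = (\<integral>\<^sup>+x\<in>E. riesz_potential F x \<partial>lborel)"
    unfolding riesz_potential_def by (intro nn_integral_cong nn_integral_multc) measurable
  finally show ?thesis .
qed

lemma nn_integral_powr_tail:
  fixes n R :: real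
  assumes "1 < n" "0 < R"
  shows "(\<integral>\<^sup>+t. ennreal (t powr - n) * indicator {R..} t \<partial>lborel) = ennreal (R powr (1 - n) / (n - 1))"
proof -
  have "(\<integral>\<^sup>+t. ennreal (t powr - n) * indicator {R..} t \<partial>lborel) = ennreal (0 - - (R powr (1 - n)) / (n - 1))"
  proof (rule nn_integral_FTC_atLeast)
    show "DERIV (\<lambda>t. - (t powr (1 - n)) / (n - 1)) x :> x powr - n" if "R \<le> x" for x
    proof -
      have "DERIV (\<lambda>t. - (t powr (1 - n)) / (n - 1)) x :> - ((1 - n) * x powr (1 - n - 1)) / (n - 1)"
        using assms that by (auto intro!: derivative_eq_intros has_real_derivative_powr)
      moreover have "- ((1 - n) * x powr (1 - n - 1)) / (n - 1) = x powr - n"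
        using assms by (simp add: field_simps)
      ultimately show ?thesis by simp
    qed
    have "((\<lambda>t::real. t powr (1 - n)) \<longlongrightarrow> 0) at_top"
      using assms by (intro tendsto_neg_powr filterlim_ident) auto
    from tendsto_divide[OF tendsto_minus[OF this] tendsto_const[of "n - 1"]]
    show "((\<lambda>t. - (t powr (1 - n)) / (n - 1)) \<longlongrightarrow> 0) at_top" using assms by simp
  qed auto
  then show ?thesis by simp
qed

text \<open>The two summands come from radii below and above the splitting radius in
  \<open>riesz_potential_le\<close>.\<close>

definition riesz_const :: "nat \<Rightarrow> real" where
  "riesz_const n = unit_ball_vol (real n) + 1 / (real n - 1)"

lemma riesz_const_pos: "2 \<le> n \<Longrightarrow> 0 < riesz_const n"
  by (auto simp: riesz_const_def intro!: add_nonneg_pos)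

text \<open>Split the defining integral at the radius of a ball of measure comparable to \<open>r\<close>.\<close>
lemma riesz_potential_le:
  fixes E :: "'a::euclidean_space set"
  assumes n: "2 \<le> DIM('a)" and [measurable]: "E \<in> sets borel"
    and E: "emeasure lborel E = ennreal r" "0 < r"
  shows "riesz_potential E y \<le> ennreal (riesz_const DIM('a) * r powr (1 / real DIM('a)))"
proof -
  let ?n = "real DIM('a)"
  define R where "R = r powr (1 / ?n)"
  have R: "0 < R" using E by (simp add: R_def)
  have "riesz_potential E y =
      (\<integral>\<^sup>+x. (\<integral>\<^sup>+t. ennreal (t powr - ?n) * indicator {t. 0 < t \<and> dist x y < t} t * indicator E x \<partial>lborel) \<partial>lborel)"
    unfolding riesz_potential_def riesz_kernel_def
    by (intro nn_integral_cong nn_integral_multc[symmetric]) measurable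
  also have "\<dots> = (\<integral>\<^sup>+t. (\<integral>\<^sup>+x. ennreal (t powr - ?n) * indicator {t. 0 < t \<and> dist x y < t} t * indicator E x \<partial>lborel) \<partial>lborel)"
    by (rule lborel_pair.Fubini'[symmetric]) (unfold indicator_def mem_Collect_eq, measurable)
  also have "\<dots> = (\<integral>\<^sup>+t. ennreal (t powr - ?n) * indicator {0<..} t * emeasure lborel (E \<inter> ball y t) \<partial>lborel)"
  proof (rule nn_integral_cong)
    fix t :: real
    have "(\<integral>\<^sup>+x. ennreal (t powr - ?n) * indicator {t. 0 < t \<and> dist x y < t} t * indicator E x \<partial>lborel)
      = (\<integral>\<^sup>+x. ennreal (t powr - ?n) * indicator {0<..} t * indicator (E \<inter> ball y t) x \<partial>lborel)"
      by (intro nn_integral_cong) (auto split: split_indicator simp: dist_commute)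
    also have "\<dots> = ennreal (t powr - ?n) * indicator {0<..} t * emeasure lborel (E \<inter> ball y t)"
      by (subst nn_integral_cmult_indicator) auto
    finally show "(\<integral>\<^sup>+x. ennreal (t powr - ?n) * indicator {t. 0 < t \<and> dist x y < t} t * indicator E x \<partial>lborel)
      = ennreal (t powr - ?n) * indicator {0<..} t * emeasure lborel (E \<inter> ball y t)" .
  qed
  \<comment> \<open>For \<open>t \<le> R\<close> the volume of the ball cancels
    \<open>t powr -n\<close>; for \<open>t > R\<close> the intersection is bounded by the measure
    \<open>r\<close> of \<open>E\<close>.\<close>
  also have "\<dots> \<le> (\<integral>\<^sup>+t. ennreal (unit_ball_vol ?n) * indicator {0..R} t
      + ennreal r * (ennreal (t powr - ?n) * indicator {R..} t) \<partial>lborel)"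
  proof (rule nn_integral_mono)
    fix t :: real
    consider "t \<le> 0" | "0 < t" "t \<le> R" | "R < t" by linarith
    then show "ennreal (t powr - ?n) * indicator {0<..} t * emeasure lborel (E \<inter> ball y t)
      \<le> ennreal (unit_ball_vol ?n) * indicator {0..R} t + ennreal r * (ennreal (t powr - ?n) * indicator {R..} t)"
    proof cases
      case 2
      have "emeasure lborel (E \<inter> ball y t) \<le> emeasure lborel (cball y t)"
        by (intro emeasure_mono) auto
      also have "\<dots> = ennreal (unit_ball_vol ?n * t ^ DIM('a))"
        using 2 by (simp add: emeasure_cball)
      finally have "ennreal (t powr - ?n) * emeasure lborel (E \<inter> ball y t)
          \<le> ennreal (t powr - ?n) * ennreal (unit_ball_vol ?n * t ^ DIM('a))"
        by (intro mult_left_mono) auto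
      also have "\<dots> = ennreal (unit_ball_vol ?n)"
        using 2 by (simp add: powr_minus powr_realpow flip: ennreal_mult')
      finally show ?thesis using 2 by (simp add: add_increasing2)
    next
      case 3
      have "emeasure lborel (E \<inter> ball y t) \<le> ennreal r"
        unfolding E(1)[symmetric] by (intro emeasure_mono) auto
      then have "ennreal (t powr - ?n) * emeasure lborel (E \<inter> ball y t) \<le> ennreal (t powr - ?n) * ennreal r"
        by (intro mult_left_mono) auto
      then show ?thesis using 3 R by (simp add: mult.commute)
    qed simp
  qed
  also have "\<dots> = ennreal (unit_ball_vol ?n) * ennreal R
      + ennreal r * ennreal (R powr (1 - ?n) / (?n - 1))"
    using R n by (simp add: nn_integral_add nn_integral_cmult nn_integral_powr_tail)
  also have "\<dots> = ennreal (unit_ball_vol ?n * R + r * (R powr (1 - ?n) / (?n - 1)))"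
    using R E n by (simp add: ennreal_mult' ennreal_plus del: times_divide_eq_right)
  \<comment> \<open>The choice \<open>R = r powr (1 / n)\<close> balances the two
    contributions.\<close>
  also have "r * (R powr (1 - ?n) / (?n - 1)) = R / (?n - 1)"
  proof -
    have "r * R powr (1 - ?n) = r powr 1 * r powr (1 / ?n * (1 - ?n))"
      using E by (simp add: R_def powr_powr)
    also have "\<dots> = R"
      
    proof -
      have "1 + 1 / ?n * (1 - ?n) = 1 / ?n" using n by (simp add: field_simps)
      then show ?thesis unfolding R_def powr_add[symmetric] by simp
    qed
    finally show ?thesis by simp
  qed
  finally show ?thesis by (simp add: riesz_const_def R_def algebra_simps)
qed

text \<open>The mean of the potential over \<open>G\<close> is at most half the claimed bound: apply
  \<open>riesz_potential_le\<close> to the larger of \<open>E\<close> and \<open>G\<close>, after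
  exchanging their roles if \<open>G\<close> is larger. The factor 2 makes some point of
  \<open>G\<close> fall below.\<close>

lemma ex_riesz_potential_le:
  fixes E G :: "'a::euclidean_space set"
  assumes n: "2 \<le> DIM('a)" and [measurable]: "E \<in> sets borel" "G \<in> sets borel"
    and E: "emeasure lborel E = ennreal r" "0 < r"
    and G: "emeasure lborel G = ennreal m" "0 < m"
  shows "\<exists>y\<in>G. riesz_potential E y \<le> ennreal (2 * riesz_const DIM('a) * r * max r m powr (1 / real DIM('a) - 1))"
proof (rule ccontr)
  let ?n = "real DIM('a)" and ?c = "riesz_const DIM('a)"
  have c: "0 < ?c" using n by (rule riesz_const_pos)
  assume "\<not> ?thesis"
  then have gt: "ennreal (2 * ?c * r * max r m powr (1 / ?n - 1)) \<le> riesz_potential E y" if "y \<in> G" for y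
    using that by (auto simp: not_le)
  have pw: "s powr (1 / ?n - 1) * s = s powr (1 / ?n)" if "0 < s" for s :: real
    using that by (simp add: powr_diff)
  have "ennreal (2 * ?c * r * max r m powr (1 / ?n - 1)) * ennreal m
      = (\<integral>\<^sup>+y\<in>G. ennreal (2 * ?c * r * max r m powr (1 / ?n - 1)) \<partial>lborel)"
    by (simp add: nn_integral_cmult G)
  also have "\<dots> \<le> (\<integral>\<^sup>+y\<in>G. riesz_potential E y \<partial>lborel)"
    by (intro nn_integral_mono) (auto split: split_indicator intro: gt)
  also have "\<dots> \<le> ennreal (?c * r * max r m powr (1 / ?n - 1)) * ennreal m"
  proof (cases "m \<le> r")
    case True
    have "(\<integral>\<^sup>+y\<in>G. riesz_potential E y \<partial>lborel) \<le> (\<integral>\<^sup>+y\<in>G. ennreal (?c * r powr (1 / ?n)) \<partial>lborel)"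
      by (intro nn_integral_mono mult_right_mono riesz_potential_le n E) auto
    also have "\<dots> = ennreal (?c * r powr (1 / ?n)) * ennreal m"
      by (simp add: nn_integral_cmult G)
    also have "?c * r powr (1 / ?n) = ?c * r * max r m powr (1 / ?n - 1)"
      using True E pw[of r] by (simp add: mult.commute mult.left_commute max_def)
    finally show ?thesis .
  next
    case False
    have "(\<integral>\<^sup>+y\<in>G. riesz_potential E y \<partial>lborel) = (\<integral>\<^sup>+x\<in>E. riesz_potential G x \<partial>lborel)"
      by (rule riesz_potential_symmetric) auto
    also have "\<dots> \<le> (\<integral>\<^sup>+x\<in>E. ennreal (?c * m powr (1 / ?n)) \<partial>lborel)"
      by (intro nn_integral_mono mult_right_mono riesz_potential_le n G) auto
    also have "\<dots> = ennreal (?c * m powr (1 / ?n)) * ennreal r"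
      by (simp add: nn_integral_cmult E)
    also have "\<dots> = ennreal (?c * m powr (1 / ?n) * r)"
      using E by (simp add: ennreal_mult'')
    also have "?c * m powr (1 / ?n) * r = ?c * r * max r m powr (1 / ?n - 1) * m"
      using False G pw[of m] by (simp add: mult.commute mult.left_commute max_def)
    finally show ?thesis using G by (simp add: ennreal_mult'')
  qed
  finally have "ennreal (2 * ?c * r * max r m powr (1 / ?n - 1) * m) \<le> ennreal (?c * r * max r m powr (1 / ?n - 1) * m)"
    using G by (simp only: ennreal_mult'' less_imp_le)
  moreover have "0 < ?c * r * max r m powr (1 / ?n - 1) * m" using c E G by simp
  ultimately show False
    using ennreal_le_iff[of "?c * r * max r m powr (1 / ?n - 1) * m"] by (simp only: less_imp_le)
qed

subsection \<open>Capacity of level sets\<close>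

text \<open>Rearrangement of the averaged kernel. A superlevel set \<open>G\<close> of measure
  \<open>k\<close> in \<open>F\<close> contains a point where the potential is controlled by
  \<open>max r k\<close>, so the level is below the right-hand integrand throughout
  \<open>(r, r + k)\<close>, an interval of the same measure that fits below \<open>m\<close> by the
  hypothesis on \<open>F\<close>. The 4 is the 2 of \<open>ex_riesz_potential_le\<close> times the 2
  lost in \<open>s < 2 * max r k\<close>.\<close>

lemma nn_integral_riesz_potential_le:
  fixes E F :: "'a::euclidean_space set" and A :: "real \<Rightarrow> real"
  assumes n: "2 \<le> DIM('a)" and [measurable]: "E \<in> sets borel" "F \<in> sets borel"
    and E: "emeasure lborel E = ennreal r" "0 < r"
    and m: "ennreal r + emeasure lborel F \<le> m" and F: "emeasure lborel F < \<infinity>"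
    and A: "\<And>s t. 0 \<le> s \<Longrightarrow> s \<le> t \<Longrightarrow> A s \<le> A t" and l: "0 < l"
  shows "(\<integral>\<^sup>+y\<in>F. ennreal (A (enn2real (riesz_potential E y) / r / (4 * riesz_const DIM('a) * l))) \<partial>lborel)
    \<le> (\<integral>\<^sup>+s\<in>{s. r < s \<and> ennreal s < m}. ennreal (A (\<bar>s powr (1 / real DIM('a) - 1)\<bar> / l)) \<partial>lborel)"
proof (rule nn_integral_le_of_superlevel_le)
  let ?c = "riesz_const DIM('a)" and ?p = "1 / real DIM('a) - 1"
  have c: "0 < ?c" using n by (rule riesz_const_pos)
  \<comment> \<open>\<open>A\<close> is monotone on nonnegative arguments only; composing with
    \<open>max 0\<close> makes it monotone on the line and hence Borel.\<close>
  have "mono (\<lambda>x. A (max 0 x))" by (auto simp: mono_def intro: A)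
  then have [measurable]: "(\<lambda>x. A (max 0 x)) \<in> borel_measurable borel"
    by (rule borel_measurable_mono)
  define w where "w y = enn2real (riesz_potential E y) / r" for y
  have w: "0 \<le> w y" for y using E by (simp add: w_def)
  have [measurable]: "w \<in> borel_measurable borel" unfolding w_def[abs_def] by measurable
  have A1: "A (enn2real (riesz_potential E y) / r / (4 * ?c * l)) = A (max 0 (w y / (4 * ?c * l)))" for y
  proof -
    have "max 0 (w y / (4 * ?c * l)) = w y / (4 * ?c * l)"
      using w[of y] c l by (intro max_absorb2) simp
    then show ?thesis by (simp add: w_def)
  qed
  have A2: "A (\<bar>s powr ?p\<bar> / l) = A (max 0 (s powr ?p / l))" for s
    using l by simp
  show f: "(\<lambda>y. ennreal (A (enn2real (riesz_potential E y) / r / (4 * ?c * l))) * indicator F y) \<in> borel_measurable lborel"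
    unfolding A1 by measurable
  have "{s. r < s \<and> ennreal s < m} \<in> sets borel" by measurable
  then show "(\<lambda>s. ennreal (A (\<bar>s powr ?p\<bar> / l)) * indicator {s. r < s \<and> ennreal s < m} s) \<in> borel_measurable lborel"
    unfolding A2 by measurable
  fix h :: real assume h: "0 < h"
  define G where "G = {y \<in> space lborel. ennreal h < ennreal (A (enn2real (riesz_potential E y) / r / (4 * ?c * l))) * indicator F y}"
  have [measurable]: "G \<in> sets borel"
    using borel_measurable_less[OF borel_measurable_const f, of "ennreal h"] by (simp add: G_def)
  have GF: "G \<subseteq> F" by (auto simp: G_def split: split_indicator_asm)
  then have "emeasure lborel G \<le> emeasure lborel F" by (intro emeasure_mono) auto
  then obtain k where k: "emeasure lborel G = ennreal k" "0 \<le> k" using F by (cases "emeasure lborel G") (auto simp: top_unique)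
  have rk: "ennreal (r + k) \<le> m"
  proof -
    have "ennreal (r + k) = ennreal r + emeasure lborel G" using k E by simp
    also have "\<dots> \<le> ennreal r + emeasure lborel F" by (intro add_left_mono) fact
    finally show ?thesis using m by simp
  qed
  show "emeasure lborel G \<le> emeasure lborel {s \<in> space lborel. ennreal h \<le>
      ennreal (A (\<bar>s powr ?p\<bar> / l)) * indicator {s. r < s \<and> ennreal s < m} s}"
  proof (cases "k = 0")
    case False
    then have k0: "0 < k" using k by simp
    obtain y where y: "y \<in> G" "riesz_potential E y \<le> ennreal (2 * ?c * r * max r k powr ?p)"
      using ex_riesz_potential_le[OF n _ _ E k(1) k0] by auto
    have "enn2real (riesz_potential E y) \<le> 2 * ?c * r * max r k powr ?p"
      using y c E by (intro enn2real_leI) auto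
    then have wy: "w y \<le> 2 * ?c * max r k powr ?p"
      using E by (simp add: w_def field_simps)
    have hA: "ennreal h < ennreal (A (w y / (4 * ?c * l)))"
      using y(1) by (auto simp: G_def w_def split: split_indicator_asm)
    have "emeasure lborel G = emeasure lborel {r<..<r + k}"
      using k by simp
    also have "\<dots> \<le> emeasure lborel {s \<in> space lborel. ennreal h \<le>
        ennreal (A (\<bar>s powr ?p\<bar> / l)) * indicator {s. r < s \<and> ennreal s < m} s}"
    proof (rule emeasure_mono)
      show "{r<..<r + k} \<subseteq> {s \<in> space lborel. ennreal h \<le>
        ennreal (A (\<bar>s powr ?p\<bar> / l)) * indicator {s. r < s \<and> ennreal s < m} s}"
      proof
        fix s assume s: "s \<in> {r<..<r + k}"
        \<comment> \<open>From \<open>s < r + k \<le> 2 * max r k\<close> and an exponent between -1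
          and 0.\<close>
        have "max r k powr ?p / 2 = 2 powr (-1) * max r k powr ?p"
          by (simp add: powr_minus)
        also have "\<dots> \<le> 2 powr ?p * max r k powr ?p"
          by (intro mult_right_mono powr_mono) auto
        also have "\<dots> = (2 * max r k) powr ?p" using E by (simp add: powr_mult)
        also have "\<dots> \<le> s powr ?p"
          using s E n by (intro powr_mono2') (auto simp: field_simps)
        finally have "2 * ?c * max r k powr ?p \<le> 4 * ?c * s powr ?p"
          using c by simp
        then have "w y \<le> (4 * ?c) * s powr ?p" using wy by simp
        then have "w y / (4 * ?c * l) \<le> ((4 * ?c) * s powr ?p) / ((4 * ?c) * l)"
          using c l by (intro divide_right_mono) auto
        then have "w y / (4 * ?c * l) \<le> s powr ?p / l"
          using c by (simp only: mult_divide_mult_cancel_left)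
        then have "A (w y / (4 * ?c * l)) \<le> A (\<bar>s powr ?p\<bar> / l)"
          using w[of y] c l by (intro A) auto
        then have "ennreal h \<le> ennreal (A (\<bar>s powr ?p\<bar> / l))"
          using hA by (meson ennreal_leI less_imp_le order_trans)
        moreover have "ennreal s < m"
          using s E rk by (intro less_le_trans[OF _ rk]) (auto simp: ennreal_less_iff simp del: ennreal_plus)
        ultimately show "s \<in> {s \<in> space lborel. ennreal h \<le>
          ennreal (A (\<bar>s powr ?p\<bar> / l)) * indicator {s. r < s \<and> ennreal s < m} s}"
          using s by simp
      qed
      show "{s \<in> space lborel. ennreal h \<le>
        ennreal (A (\<bar>s powr ?p\<bar> / l)) * indicator {s. r < s \<and> ennreal s < m} s} \<in> sets lborel"
        unfolding A2 by measurable
    qed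
    finally show ?thesis .
  qed (simp add: k)
qed (rule lborel.sigma_finite_measure_axioms)+

lemma DERIV_max_0_power2:
  fixes x :: real
  shows "((\<lambda>x. (max 0 x)\<^sup>2) has_real_derivative 2 * max 0 x) (at x)"
proof -
  consider "x < 0" | "x = 0" | "0 < x" by linarith
  then show ?thesis
  proof cases
    case 1
    have "((\<lambda>x. 0) has_real_derivative 2 * max 0 x) (at x)" using 1 by simp
    then show ?thesis
      by (rule DERIV_cong_ev[THEN iffD1, rotated 3])
         (use eventually_nhds_in_open[of "{..<0}" x] 1 in \<open>auto elim!: eventually_mono\<close>)
  next
    case 2
    have "((\<lambda>h::real. (max 0 h)\<^sup>2 / h) \<longlongrightarrow> 0) (at 0)"
    proof (rule Lim_null_comparison)
      show "\<forall>\<^sub>F h in at 0. norm ((max 0 h)\<^sup>2 / h) \<le> \<bar>h\<bar>"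
        by (auto simp: eventually_at_filter max_def power2_eq_square)
      show "((\<lambda>h::real. \<bar>h\<bar>) \<longlongrightarrow> 0) (at 0)" by (auto intro!: tendsto_eq_intros)
    qed
    then show ?thesis using 2 by (simp add: DERIV_def)
  next
    case 3
    have "((\<lambda>x. x\<^sup>2) has_real_derivative 2 * max 0 x) (at x)" using 3 by (auto intro!: derivative_eq_intros)
    then show ?thesis
      by (rule DERIV_cong_ev[THEN iffD1, rotated 3])
         (use eventually_nhds_in_open[of "{0<..}" x] 3 in \<open>auto elim!: eventually_mono\<close>)
  qed
qed

text \<open>Replaces piecewise linear truncation: a \<open>C^1\<close> function stays
  \<open>C^1\<close> after composition, so the Riesz bound applies, at the price of slope 2 instead
  of 1.\<close>

lemma ex_C1_cutoff:
  obtains H h :: "real \<Rightarrow> real"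
  where "\<And>t. (H has_real_derivative h t) (at t)" "continuous_on UNIV h"
    and "\<And>t. \<bar>t\<bar> \<le> 1 \<Longrightarrow> H t = 0" "\<And>t. \<bar>t\<bar> \<le> 1 \<Longrightarrow> h t = 0"
    and "\<And>t. 2 \<le> \<bar>t\<bar> \<Longrightarrow> H t = 1" "\<And>t. 2 \<le> \<bar>t\<bar> \<Longrightarrow> h t = 0" "\<And>t. \<bar>h t\<bar> \<le> 2"
proof -
  \<comment> \<open>\<open>q\<close> is the quadratic spline whose derivative is the tent on
    \<open>[1, 2]\<close> with height 2 at \<open>3/2\<close>, hence of area 1; \<open>H\<close> is
    its even reflection.\<close>
  define q :: "real \<Rightarrow> real" where
    "q t = 2 * ((max 0 (t - 1))\<^sup>2 - 2 * (max 0 (t - 3/2))\<^sup>2 + (max 0 (t - 2))\<^sup>2)" for t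
  define q' :: "real \<Rightarrow> real" where
    "q' t = 4 * (max 0 (t - 1) - 2 * max 0 (t - 3/2) + max 0 (t - 2))" for t
  define p :: "real \<Rightarrow> real" where "p t = (max 0 t)\<^sup>2" for t
  have p: "((\<lambda>t. p (t - c)) has_real_derivative 2 * max 0 (t - c)) (at t)" for t c
  proof -
    have "(p has_real_derivative 2 * max 0 (t - c)) (at (t - c))"
      unfolding p_def[abs_def] by (rule DERIV_max_0_power2)
    moreover have "((\<lambda>t. t - c) has_real_derivative 1) (at t)" by (auto intro!: derivative_eq_intros)
    ultimately show ?thesis using DERIV_chain2 by fastforce
  qed
  have q: "(q has_real_derivative q' t) (at t)" for t
    unfolding q_def[abs_def] q'_def p_def[symmetric] by (auto intro!: derivative_eq_intros p)
  define H where "H t = q t + q (- t)" for t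
  define h where "h t = q' t - q' (- t)" for t
  show ?thesis
  proof
    show "(H has_real_derivative h t) (at t)" for t
      unfolding H_def[abs_def] h_def by (auto intro!: derivative_eq_intros q DERIV_chain2[OF q])
    show "continuous_on UNIV h"
      unfolding h_def[abs_def] q'_def by (intro continuous_intros)
    show "H t = 0" "h t = 0" if "\<bar>t\<bar> \<le> 1" for t
      using that by (auto simp: H_def h_def q_def q'_def)
    have q2: "q t = 1" if "2 \<le> t" for t
      using that by (simp add: q_def power2_eq_square algebra_simps)
    show "H t = 1" if "2 \<le> \<bar>t\<bar>" for t
    proof -
      have "q (- \<bar>t\<bar>) = 0" using that by (simp add: q_def)
      then show ?thesis using q2[OF that] by (auto simp: H_def abs_if split: if_splits)
    qed
    show "h t = 0" if "2 \<le> \<bar>t\<bar>" for t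
      using that by (auto simp: h_def q'_def max_def abs_if split: if_splits)
    show "\<bar>h t\<bar> \<le> 2" for t
      by (auto simp: h_def q'_def max_def abs_if)
  qed
qed

text \<open>The gradient of the truncation of \<open>u\<close> lives on \<open>F\<close>, which is disjoint from \<open>E\<close>; this is why
  the norm of \<open>\<zeta>\<close> over \<open>(r, m)\<close> suffices, also when \<open>r\<close> is close to \<open>m\<close>.\<close>
lemma (in young_fun) level_set_capacity:
  fixes u :: "'a::euclidean_space \<Rightarrow> real" and G :: "'a \<Rightarrow> 'a"
  defines "\<omega> \<equiv> measure lborel (ball (0::'a) 1)"
  assumes n: "2 \<le> DIM('a)"
    and der: "\<And>y. (u has_derivative (\<lambda>h. G y \<bullet> h)) (at y)"
    and cont: "continuous_on UNIV G" and supp: "\<And>y. R \<le> norm y \<Longrightarrow> u y = 0"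
    and \<theta>: "0 < \<theta>" and E_def: "E = {x. 2 * \<theta> < \<bar>u x\<bar>}" and F_def: "F = {x. \<theta> < \<bar>u x\<bar> \<and> \<bar>u x\<bar> \<le> 2 * \<theta>}"
    and E: "emeasure lborel E = ennreal r" "0 < r"
    and m: "ennreal r + emeasure lborel F \<le> m" and F: "emeasure lborel F < \<infinity>"
    and bdd: "\<And>t. 0 \<le> t \<Longrightarrow> bdd_above ((\<lambda>s. s * t - A s) ` {0<..})"
    and l: "0 < l" "(\<integral>\<^sup>+s\<in>{s. r < s \<and> ennreal s < m}.
        ennreal (young_conj A (\<bar>s powr (1 / real DIM('a) - 1)\<bar> / l)) \<partial>lborel) \<le> 1"
    and \<beta>: "0 < \<beta>" "(\<integral>\<^sup>+x\<in>F. ennreal (A (\<beta> * norm (G x))) \<partial>lborel) \<le> 1"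
  shows "\<omega> * \<theta> * \<beta> \<le> 16 * riesz_const DIM('a) * l"
proof -
  let ?c = "riesz_const DIM('a)"
  have c: "0 < ?c" using n by (rule riesz_const_pos)
  obtain H h where H: "\<And>t. (H has_real_derivative h t) (at t)" "continuous_on UNIV h"
    and H0: "\<And>t. \<bar>t\<bar> \<le> 1 \<Longrightarrow> H t = 0" "\<And>t. \<bar>t\<bar> \<le> 1 \<Longrightarrow> h t = 0"
    and H1: "\<And>t. 2 \<le> \<bar>t\<bar> \<Longrightarrow> H t = 1" "\<And>t. 2 \<le> \<bar>t\<bar> \<Longrightarrow> h t = 0" and h2: "\<And>t. \<bar>h t\<bar> \<le> 2"
    using ex_C1_cutoff by blast
  have contu: "continuous_on UNIV u"
    using der by (auto simp: continuous_on_eq_continuous_at intro: has_derivative_continuous)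
  have [measurable]: "u \<in> borel_measurable borel" "G \<in> borel_measurable borel"
    using cont contu by (auto intro: borel_measurable_continuous_onI)
  have [measurable]: "E \<in> sets borel" "F \<in> sets borel"
    unfolding E_def F_def by measurable
  have [measurable]: "(\<lambda>x. A (\<beta> * norm (G x))) \<in> borel_measurable borel"
    by (intro borel_measurable_continuous_onI continuous_on_compose2[OF continuous_on_nonneg]
          continuous_intros cont) (use \<beta> in auto)
  \<comment> \<open>Gradient of the truncation \<open>H (u / \<theta>)\<close>; it vanishes off
    \<open>F\<close>, where \<open>h\<close> does, and has size at most \<open>2 / \<theta>\<close>
    times that of \<open>G\<close>.\<close>
  define V where "V y = (h (u y / \<theta>) / \<theta>) *\<^sub>R G y" for y
  have derV: "((\<lambda>y. H (u y / \<theta>)) has_derivative (\<lambda>k. V y \<bullet> k)) (at y)" for y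
  proof -
    have "((\<lambda>y. u y / \<theta>) has_derivative (\<lambda>k. (G y \<bullet> k) / \<theta>)) (at y)"
      using der \<theta> by (auto intro!: derivative_eq_intros)
    from has_derivative_compose[OF this H(1)[unfolded has_field_derivative_def]]
    show ?thesis by (simp add: V_def)
  qed
  have contV: "continuous_on UNIV V"
    unfolding V_def[abs_def] using \<theta>
    by (intro continuous_intros continuous_on_compose2[OF H(2)] cont contu) auto
  define w where "w y = enn2real (riesz_potential E y) / r" for y
  have w0: "0 \<le> w y" for y using E by (simp add: w_def)
  have pot: "riesz_potential E y = ennreal (r * w y)" for y
  proof -
    have "riesz_potential E y < top"
      using riesz_potential_le[OF n _ E, of y] by (auto intro: le_less_trans)
    then show ?thesis using E by (simp add: w_def)
  qed
  have [measurable]: "w \<in> borel_measurable borel" unfolding w_def[abs_def] by measurable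
  \<comment> \<open>Chosen so that \<open>2 / \<theta> * r * w y\<close> equals
    \<open>a * \<beta> * w y / (4 * c * l)\<close>: Young's inequality then applies to
    \<open>\<beta> * norm (G y)\<close> and the normalised kernel.\<close>
  define a where "a = 8 * ?c * l * r / (\<theta> * \<beta>)"
  have a: "0 < a" using c l \<theta> \<beta> E by (simp add: a_def)
  have pointwise: "ennreal (norm (V y)) * riesz_potential E y \<le>
      ennreal a * (ennreal (A (\<beta> * norm (G y))) * indicator F y
        + ennreal (young_conj A (w y / (4 * ?c * l))) * indicator F y)" for y
  proof (cases "y \<in> F")
    case True
    have "norm (V y) \<le> 2 / \<theta> * norm (G y)"
      using \<theta> h2[of "u y / \<theta>"] by (auto simp: V_def intro!: mult_right_mono divide_right_mono)
    then have "norm (V y) * (r * w y) \<le> 2 / \<theta> * norm (G y) * (r * w y)"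
      using E w0 by (intro mult_right_mono) auto
    also have "\<dots> = a * ((\<beta> * norm (G y)) * (w y / (4 * ?c * l)))"
      using \<theta> \<beta> c l by (simp add: a_def field_simps)
    also have "\<dots> \<le> a * (A (\<beta> * norm (G y)) + young_conj A (w y / (4 * ?c * l)))"
      using a \<beta> w0[of y] c l by (intro mult_left_mono young_ineq[OF bdd]) auto
    finally have "ennreal (norm (V y) * (r * w y)) \<le> ennreal (a * (A (\<beta> * norm (G y)) + young_conj A (w y / (4 * ?c * l))))"
      by (rule ennreal_leI)
    moreover have "0 \<le> young_conj A (w y / (4 * ?c * l))" "0 \<le> A (\<beta> * norm (G y))"
      using w0[of y] c l \<beta> by (auto intro!: conj_nonneg[OF bdd] nonneg)
    ultimately show ?thesis
      using True a by (simp add: pot ennreal_mult' ennreal_plus)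
  next
    case False
    then have "\<bar>u y / \<theta>\<bar> \<le> 1 \<or> 2 \<le> \<bar>u y / \<theta>\<bar>"
      using \<theta> by (auto simp: F_def field_simps abs_mult)
    then have "V y = 0" using H0(2) H1(2) by (auto simp: V_def)
    then show ?thesis by simp
  qed
  have conjmeas: "(\<lambda>y. ennreal (young_conj A (w y / (4 * ?c * l)))) \<in> borel_measurable borel"
  proof -
    have "mono (\<lambda>x. young_conj A (max 0 x))" by (auto simp: mono_def intro: conj_mono[OF bdd])
    then have [measurable]: "(\<lambda>x. young_conj A (max 0 x)) \<in> borel_measurable borel"
      by (rule borel_measurable_mono)
    have "(\<lambda>y. ennreal (young_conj A (max 0 (w y / (4 * ?c * l))))) \<in> borel_measurable borel"
      by measurable
    then show ?thesis using w0 c l by (simp add: max_def)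
  qed
  have "ennreal r * ennreal \<omega> = emeasure lborel E * emeasure lborel (ball (0::'a) 1)"
    unfolding E \<omega>_def by (subst emeasure_eq_ennreal_measure) (use emeasure_lborel_ball_finite[of "0::'a" 1] in auto)
  also have "\<dots> \<le> (\<integral>\<^sup>+y. ennreal (norm (V y)) * riesz_potential E y \<partial>lborel)"
  proof (rule emeasure_le_integral_grad_riesz_potential[OF derV contV])
    show "H (u y / \<theta>) = 0" if "R \<le> norm y" for y using supp[OF that] by (simp add: H0)
    show "1 \<le> \<bar>H (u x / \<theta>)\<bar>" if "x \<in> E" for x
      using that \<theta> by (subst H1) (auto simp: E_def field_simps abs_mult)
  qed auto
  also have "\<dots> \<le> (\<integral>\<^sup>+y. ennreal a * (ennreal (A (\<beta> * norm (G y))) * indicator F y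
        + ennreal (young_conj A (w y / (4 * ?c * l))) * indicator F y) \<partial>lborel)"
    by (intro nn_integral_mono pointwise)
  also have "\<dots> = ennreal a * ((\<integral>\<^sup>+y\<in>F. ennreal (A (\<beta> * norm (G y))) \<partial>lborel)
      + (\<integral>\<^sup>+y\<in>F. ennreal (young_conj A (w y / (4 * ?c * l))) \<partial>lborel))"
  proof -
    have m1: "(\<lambda>y. ennreal (A (\<beta> * norm (G y))) * indicator F y) \<in> borel_measurable lborel"
      by measurable
    have m2: "(\<lambda>y. ennreal (young_conj A (w y / (4 * ?c * l))) * indicator F y) \<in> borel_measurable lborel"
      using conjmeas by (intro borel_measurable_times_ennreal borel_measurable_indicator) simp_all
    show ?thesis
      by (simp only: nn_integral_cmult[OF borel_measurable_add[OF m1 m2]] nn_integral_add[OF m1 m2])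
  qed
  \<comment> \<open>One modular is at most 1 by the hypothesis on \<open>\<beta>\<close>, the other
    by the rearrangement bound and the admissibility of \<open>l\<close>.\<close>
  also have "\<dots> \<le> ennreal a * (1 + 1)"
  proof (intro mult_left_mono add_mono \<beta>)
    show "(\<integral>\<^sup>+y\<in>F. ennreal (young_conj A (w y / (4 * ?c * l))) \<partial>lborel) \<le> 1"
      unfolding w_def
      by (rule order_trans[OF nn_integral_riesz_potential_le[OF n _ _ E m F conj_mono[OF bdd] l(1)] l(2)]) auto
  qed auto
  also have "\<dots> = ennreal (a * 2)" using a by (simp add: ennreal_mult')
  finally have "ennreal (r * \<omega>) \<le> ennreal (a * 2)"
    using E(2) by (simp only: ennreal_mult' less_imp_le)
  then have "r * \<omega> \<le> a * 2"
    using a ennreal_le_iff[of "a * 2" "r * \<omega>"] by simp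
  then have "r * (\<omega> * \<theta> * \<beta>) \<le> r * (16 * ?c * l)"
    using \<theta> \<beta> by (simp add: a_def field_simps)
  then show ?thesis using E(2) by (rule mult_left_le_imp_le)
qed

text \<open>By \<open>\<Delta>'\<close> the factor \<open>\<beta>\<close> with
  \<open>A \<beta> = 1 / (C * e)\<close> makes the energy of \<open>\<beta> * G\<close> at most 1,
  and \<open>inv_mult_lower\<close> converts \<open>1 / \<beta>\<close> into a multiple of the
  inverse at \<open>e\<close>. \<open>K\<close> is independent of \<open>u\<close>,
  \<open>\<theta>\<close>, \<open>m\<close> and \<open>l\<close>; any \<open>l\<close> admissible
  for the norm of \<open>\<zeta>\<close> is allowed.\<close>

lemma (in young_fun_delta) level_le_inv_energy:
  assumes n: "2 \<le> DIM('a::euclidean_space)"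
    and bdd: "\<And>t. 0 \<le> t \<Longrightarrow> bdd_above ((\<lambda>s. s * t - A s) ` {0<..})"
    and D: "1 < D" "\<And>s t. 0 \<le> s \<Longrightarrow> 0 \<le> t \<Longrightarrow> young_conj A (s * t) \<le> D * young_conj A s * young_conj A t"
  obtains K where "0 < K" and "\<And>(u :: 'a \<Rightarrow> real) G R \<theta> r m l e.
      (\<And>y. (u has_derivative (\<lambda>h. G y \<bullet> h)) (at y)) \<Longrightarrow> continuous_on UNIV G \<Longrightarrow>
      (\<And>y. R \<le> norm y \<Longrightarrow> u y = 0) \<Longrightarrow> 0 < \<theta> \<Longrightarrow>
      emeasure lborel {x. 2 * \<theta> < \<bar>u x\<bar>} = ennreal r \<Longrightarrow> 0 < r \<Longrightarrow>
      ennreal r + emeasure lborel {x. \<theta> < \<bar>u x\<bar> \<and> \<bar>u x\<bar> \<le> 2 * \<theta>} \<le> m \<Longrightarrow>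
      emeasure lborel {x. \<theta> < \<bar>u x\<bar> \<and> \<bar>u x\<bar> \<le> 2 * \<theta>} < \<infinity> \<Longrightarrow>
      0 < l \<Longrightarrow> (\<integral>\<^sup>+s\<in>{s. r < s \<and> ennreal s < m}.
        ennreal (young_conj A (\<bar>s powr (1 / real DIM('a) - 1)\<bar> / l)) \<partial>lborel) \<le> 1 \<Longrightarrow>
      (\<integral>\<^sup>+x\<in>{x. \<theta> < \<bar>u x\<bar> \<and> \<bar>u x\<bar> \<le> 2 * \<theta>}. ennreal (A (norm (G x))) \<partial>lborel) = ennreal e \<Longrightarrow>
      0 \<le> e \<Longrightarrow> \<theta> \<le> K * l * young_inv A e"
proof -
  let ?c = "riesz_const DIM('a)"
  define \<omega> where "\<omega> = measure lborel (ball (0::'a) 1)"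
  have c: "0 < ?c" using n by (rule riesz_const_pos)
  have \<omega>: "0 < \<omega>" unfolding \<omega>_def by (rule content_ball_pos) simp
  \<comment> \<open>The bound of \<open>inv_mult_lower\<close> at \<open>k = 1 / C\<close>, the
    product of \<open>A \<beta> = 1 / (C * e)\<close> and \<open>A x = e\<close> below.\<close>
  define c0 where "c0 = young_inv A (D * (1 / C)) / (2 * D)"
  have c0: "0 < c0" using D C_gt by (auto simp: c0_def intro!: divide_pos_pos inv_pos)
  show ?thesis
  proof
    show "0 < 16 * ?c / (\<omega> * c0)" using c \<omega> c0 by simp
    fix u :: "'a \<Rightarrow> real" and G R \<theta> r m l e
    assume u: "\<And>y. (u has_derivative (\<lambda>h. G y \<bullet> h)) (at y)" "continuous_on UNIV G"
      "\<And>y. R \<le> norm y \<Longrightarrow> u y = 0" and \<theta>: "0 < \<theta>" and E: "emeasure lborel {x. 2 * \<theta> < \<bar>u x\<bar>} = ennreal r" "0 < r"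
      and m: "ennreal r + emeasure lborel {x. \<theta> < \<bar>u x\<bar> \<and> \<bar>u x\<bar> \<le> 2 * \<theta>} \<le> m"
      and F: "emeasure lborel {x. \<theta> < \<bar>u x\<bar> \<and> \<bar>u x\<bar> \<le> 2 * \<theta>} < \<infinity>"
      and l: "0 < l" "(\<integral>\<^sup>+s\<in>{s. r < s \<and> ennreal s < m}.
        ennreal (young_conj A (\<bar>s powr (1 / real DIM('a) - 1)\<bar> / l)) \<partial>lborel) \<le> 1"
      and e: "(\<integral>\<^sup>+x\<in>{x. \<theta> < \<bar>u x\<bar> \<and> \<bar>u x\<bar> \<le> 2 * \<theta>}. ennreal (A (norm (G x))) \<partial>lborel) = ennreal e" "0 \<le> e"
    have contu: "continuous_on UNIV u"
      using u(1) by (auto simp: continuous_on_eq_continuous_at intro: has_derivative_continuous)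
    have [measurable]: "u \<in> borel_measurable borel" 
      using contu by (rule borel_measurable_continuous_onI)
    have [measurable]: "(\<lambda>x. A (norm (G x))) \<in> borel_measurable borel"
      by (intro borel_measurable_continuous_onI continuous_on_compose2[OF continuous_on_nonneg]
            continuous_intros u(2)) auto
    have scale: "(\<integral>\<^sup>+x\<in>{x. \<theta> < \<bar>u x\<bar> \<and> \<bar>u x\<bar> \<le> 2 * \<theta>}. ennreal (A (\<beta> * norm (G x))) \<partial>lborel)
        \<le> ennreal (C * A \<beta> * e)" if "0 < \<beta>" for \<beta>
    proof -
      have C0: "0 \<le> C * A \<beta>" using C_gt nonneg[of \<beta>] that by simp
      have "(\<integral>\<^sup>+x\<in>{x. \<theta> < \<bar>u x\<bar> \<and> \<bar>u x\<bar> \<le> 2 * \<theta>}. ennreal (A (\<beta> * norm (G x))) \<partial>lborel) \<le>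
        (\<integral>\<^sup>+x. ennreal (C * A \<beta>) * (ennreal (A (norm (G x))) * indicator {x. \<theta> < \<bar>u x\<bar> \<and> \<bar>u x\<bar> \<le> 2 * \<theta>} x) \<partial>lborel)"
      proof (rule nn_integral_mono)
        fix x
        have "ennreal (A (\<beta> * norm (G x))) \<le> ennreal (C * A \<beta> * A (norm (G x)))"
          using that by (intro ennreal_leI delta) auto
        also have "\<dots> = ennreal (C * A \<beta>) * ennreal (A (norm (G x)))"
          using C0 by (rule ennreal_mult')
        finally show "ennreal (A (\<beta> * norm (G x))) * indicator {x. \<theta> < \<bar>u x\<bar> \<and> \<bar>u x\<bar> \<le> 2 * \<theta>} x
          \<le> ennreal (C * A \<beta>) * (ennreal (A (norm (G x))) * indicator {x. \<theta> < \<bar>u x\<bar> \<and> \<bar>u x\<bar> \<le> 2 * \<theta>} x)"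
          by (auto split: split_indicator)
      qed
      also have "\<dots> = ennreal (C * A \<beta>) * ennreal e"
        by (subst nn_integral_cmult) (auto simp: e)
      finally show ?thesis using C0 by (simp add: ennreal_mult')
    qed
    have cap: "\<omega> * \<theta> * \<beta> \<le> 16 * ?c * l" if "0 < \<beta>" "C * A \<beta> * e \<le> 1" for \<beta>
      unfolding \<omega>_def
    proof (rule level_set_capacity[OF n u \<theta> refl refl E m F bdd l that(1)])
      have "ennreal (C * A \<beta> * e) \<le> 1" using that(2) by (simp add: ennreal_le_1)
      then show "(\<integral>\<^sup>+x\<in>{x. \<theta> < \<bar>u x\<bar> \<and> \<bar>u x\<bar> \<le> 2 * \<theta>}. ennreal (A (\<beta> * norm (G x))) \<partial>lborel) \<le> 1"
        using scale[OF that(1)] by (rule order_trans[rotated])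
    qed
    show "\<theta> \<le> 16 * ?c / (\<omega> * c0) * l * young_inv A e"
    proof (cases "e = 0")
      case True
      \<comment> \<open>With zero energy every \<open>\<beta>\<close> is admissible; this one makes
        the left side \<open>32 * c * l\<close>, a contradiction.\<close>
      have "\<omega> * \<theta> * (32 * ?c * l / (\<omega> * \<theta>)) \<le> 16 * ?c * l"
        using True \<omega> \<theta> c l by (intro cap) auto
      then have False using \<omega> \<theta> c l by simp
      then show ?thesis ..
    next
      case False
      then have e0: "0 < e" using e by simp
      define \<beta> where "\<beta> = young_inv A (1 / (C * e))"
      define x where "x = young_inv A e"
      have \<beta>: "0 < \<beta>" "A \<beta> = 1 / (C * e)" using e0 C_gt by (auto simp: \<beta>_def intro!: inv_pos apply_inv)
      have x: "0 < x" "A x = e" using e0 by (auto simp: x_def intro!: inv_pos apply_inv)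
      have "c0 \<le> \<beta> * x"
        unfolding c0_def using \<beta> x e0 C_gt by (intro inv_mult_lower[OF bdd D]) auto
      then have "\<omega> * \<theta> * c0 \<le> \<omega> * \<theta> * (\<beta> * x)"
        using \<omega> \<theta> by (intro mult_left_mono) auto
      also have "\<dots> = (\<omega> * \<theta> * \<beta>) * x" by simp
      also have "\<dots> \<le> 16 * ?c * l * x"
        using \<beta> e0 C_gt x by (intro mult_right_mono cap) auto
      finally show ?thesis using \<omega> c0 by (simp add: x_def field_simps)
    qed
  qed
qed

subsection \<open>The weighted inequality\<close>

text \<open>Outside the compact support \<open>u\<close> is locally zero, so differentiability and
  continuity of the gradient on \<open>\<Omega>\<close> extend to the whole space, where the ray
  argument takes place.\<close>

lemma C1c_grad:
  fixes u :: "'a::euclidean_space \<Rightarrow> real"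
  assumes "open \<Omega>" "u \<in> C1c \<Omega>"
  obtains K where "compact K" "K \<subseteq> \<Omega>" "\<And>y. y \<notin> K \<Longrightarrow> u y = 0" "\<And>y. y \<notin> K \<Longrightarrow> grad u y = 0"
    "\<And>y. (u has_derivative (\<lambda>h. grad u y \<bullet> h)) (at y)" "continuous_on UNIV (grad u)"
proof -
  define K where "K = closure {x. u x \<noteq> 0}"
  have K: "compact K" "K \<subseteq> \<Omega>" and diff: "\<And>x. x \<in> \<Omega> \<Longrightarrow> u differentiable (at x)"
    and cont: "continuous_on \<Omega> (grad u)"
    using assms by (auto simp: C1c_def K_def)
  have u0: "u y = 0" if "y \<notin> K" for y
    using that closure_subset[of "{x. u x \<noteq> 0}"] by (auto simp: K_def)
  have oK: "open (- K)" using K(1) by (simp add: compact_imp_closed open_Compl)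
  have der0: "(u has_derivative (\<lambda>_. 0)) (at y)" if "y \<notin> K" for y
    by (rule has_derivative_transform_within_open[OF has_derivative_const[of 0] oK]) (use that u0 in auto)
  have g0: "grad u y = 0" if "y \<notin> K" for y
    using frechet_derivative_at[OF der0[OF that], symmetric] by (simp add: grad_def)
  have "u differentiable (at y)" for y
    using der0[of y] diff[of y] K(2) by (auto simp: differentiable_def)
  then have works: "(u has_derivative frechet_derivative u (at y)) (at y)" for y
    by (simp add: frechet_derivative_works)
  have der: "(u has_derivative (\<lambda>h. grad u y \<bullet> h)) (at y)" for y
  proof -
    interpret bounded_linear "frechet_derivative u (at y)"
      using works by (rule has_derivative_bounded_linear)
    have "frechet_derivative u (at y) h = grad u y \<bullet> h" for h
    proof -
      have "frechet_derivative u (at y) h = frechet_derivative u (at y) (\<Sum>i\<in>Basis. (h \<bullet> i) *\<^sub>R i)"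
        by (simp add: euclidean_representation)
      also have "\<dots> = (\<Sum>i\<in>Basis. (h \<bullet> i) * frechet_derivative u (at y) i)"
        by (simp add: sum scale)
      also have "\<dots> = grad u y \<bullet> h"
        by (simp add: grad_def inner_sum_left inner_commute[of h] mult.commute)
      finally show ?thesis .
    qed
    then have "frechet_derivative u (at y) = (\<lambda>h. grad u y \<bullet> h)" by blast
    then show ?thesis using works[of y] by simp
  qed
  have "continuous_on (\<Omega> \<union> - K) (grad u)"
    using g0 by (intro continuous_on_open_Un assms oK cont continuous_on_eq[OF continuous_on_const[of _ 0]]) auto
  moreover have "\<Omega> \<union> - K = UNIV" using K by auto
  ultimately show ?thesis using that[OF K u0 g0 der] by simp
qed

text \<open>An infinite \<open>\<zeta>\<close>-norm makes \<open>\<eta> = \<infinity>\<close> and hence forces \<open>g\<^sup>*\<^sup>* = 0\<close>; and \<open>r = |\<Omega>|\<close> is excluded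
  by the hypothesis \<open>cap\<close>, because then every \<open>l > 0\<close> is admissible.\<close>
lemma weighted_level_estimate:
  fixes \<Omega> :: "'a::euclidean_space set"
  assumes "young_fun_delta \<Psi> \<psi> C" and "open \<Omega>" and g: "g \<in> X_space \<Phi> \<Psi> \<Omega>"
    and E: "E \<in> sets lebesgue" "E \<subseteq> \<Omega>" "emeasure lebesgue E = ennreal r" "0 < r"
    and K: "0 < K" and T: "0 \<le> T" and \<theta>: "0 < \<theta>"
    and cap: "\<And>l. 0 < l \<Longrightarrow> (\<integral>\<^sup>+s\<in>{s. r < s \<and> ennreal s < emeasure lebesgue \<Omega>}.
        ennreal (young_conj \<Phi> (\<bar>s powr (1 / real DIM('a) - 1)\<bar> / l)) \<partial>lborel) \<le> 1 \<Longrightarrow> \<theta> \<le> K * l * T"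
  shows "(\<integral>\<^sup>+x\<in>E. ennreal \<bar>g x\<bar> \<partial>lebesgue) * ennreal (\<Psi> (4 * \<theta>))
    \<le> ennreal (C\<^sup>2 * \<Psi> (4 * K) * enn2real (X_norm \<Phi> \<Psi> \<Omega> g) * \<Psi> T)"
proof -
  interpret young_fun_delta \<Psi> \<psi> C by fact
  define m where "m = emeasure lebesgue \<Omega>"
  define X where "X = X_norm \<Phi> \<Psi> \<Omega> g"
  define Z where "Z = zeta_lux DIM('a) \<Phi> m r"
  have gm: "g \<in> borel_measurable (restrict_space lebesgue \<Omega>)" and X: "X < top"
    using g by (auto simp: X_space_def X_def)
  have "ennreal r \<le> m" unfolding m_def E(3)[symmetric] using E \<open>open \<Omega>\<close> by (intro emeasure_mono) auto
  moreover have "ennreal r \<noteq> m"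
  proof
    assume eq: "ennreal r = m"
    have empty: "{s. r < s \<and> ennreal s < m} = {}"
      using E(4) by (auto simp: eq[symmetric] ennreal_less_iff)
    have lin: "\<theta> \<le> K * l * T" if "0 < l" for l
      using that by (intro cap) (auto simp: empty m_def[symmetric])
    \<comment> \<open>With this \<open>d\<close>, the value \<open>l = \<theta> / d\<close> would
      give \<open>d \<le> K * T\<close>, which is false.\<close>
    define d where "d = 2 * (K * T + 1)"
    have d: "0 < d" using K T by (simp add: d_def add_nonneg_pos)
    have "\<theta> \<le> K * (\<theta> / d) * T" by (rule lin) (use \<theta> d in simp)
    then have "\<theta> * d \<le> \<theta> * (K * T)" using d by (simp add: field_simps)
    then have "\<theta> * (2 * (K * T + 1)) \<le> \<theta> * (K * T)" by (simp only: d_def)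
    then have "2 * (K * T + 1) \<le> K * T" using \<theta> by simp
    then show False using mult_nonneg_nonneg[OF less_imp_le[OF K] T] unfolding distrib_left by linarith
  qed
  ultimately have "ennreal r < m" by simp
  then have supr: "max_fun g \<Omega> r * eta DIM('a) \<Phi> \<Psi> m r \<le> X"
    unfolding X_def X_norm_def m_def[symmetric] using E by (intro SUP_upper) auto
  have Eg: "(\<integral>\<^sup>+x\<in>E. ennreal \<bar>g x\<bar> \<partial>lebesgue) \<le> ennreal r * max_fun g \<Omega> r"
    by (rule nn_integral_le_max_fun) fact+
  show ?thesis
  proof (cases "Z = top")
    case True
    then have "max_fun g \<Omega> r * top < top"
      using supr X by (auto simp: eta_def Z_def)
    then have "max_fun g \<Omega> r = 0" by (auto simp: ennreal_mult_eq_top_iff less_top[symmetric])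
    then show ?thesis using Eg by simp
  next
    case False
    \<comment> \<open>For \<open>T = 0\<close> the hypothesis \<open>cap\<close> would leave no
      admissible \<open>l\<close>, and the norm would be the infimum of the empty set,
      \<open>top\<close>.\<close>
    have T0: "0 < T"
    proof (rule ccontr)
      assume "\<not> 0 < T"
      then have "T = 0" using T by simp
      then have "\<not> (\<integral>\<^sup>+s\<in>{s. r < s \<and> ennreal s < m}.
        ennreal (young_conj \<Phi> (\<bar>s powr (1 / real DIM('a) - 1)\<bar> / l)) \<partial>lborel) \<le> 1" if "0 < l" for l
        using cap[of l] that \<theta> by (auto simp: m_def)
      then have "Z = Inf {}" unfolding Z_def zeta_lux_def by (intro arg_cong[of _ _ Inf]) blast
      then show False using False by simp
    qed
    define z where "z = enn2real Z"
    have Zz: "Z = ennreal z" using False by (simp add: z_def less_top)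
    \<comment> \<open>\<open>cap\<close> bounds every admissible \<open>l\<close> from below, hence
      also their infimum.\<close>
    have "ennreal (\<theta> / (K * T)) \<le> Z"
      unfolding Z_def zeta_lux_def
    proof (rule Inf_greatest, clarify)
      fix l :: real assume "0 < l" "(\<integral>\<^sup>+s\<in>{s. r < s \<and> ennreal s < m}.
        ennreal (young_conj \<Phi> (\<bar>s powr (1 / real DIM('a) - 1)\<bar> / l)) \<partial>lborel) \<le> 1"
      then have "\<theta> \<le> K * l * T" by (intro cap) (auto simp: m_def)
      then show "ennreal (\<theta> / (K * T)) \<le> ennreal l"
        using K T0 by (intro ennreal_leI) (simp add: field_simps)
    qed
    moreover have z: "0 \<le> z" by (simp add: z_def)
    ultimately have "\<theta> / (K * T) \<le> z" by (simp add: Zz ennreal_le_iff)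
    then have \<theta>z: "\<theta> \<le> K * (z * T)" using K T0 by (simp add: field_simps)
    \<comment> \<open>\<open>\<Delta>'\<close> twice separates the constant \<open>4 * K\<close>,
      the norm \<open>z\<close> and \<open>T\<close>; the factor \<open>\<Psi> z\<close> then forms
      \<open>eta\<close> together with \<open>r\<close>.\<close>
    have "\<Psi> (4 * \<theta>) \<le> \<Psi> ((4 * K) * (z * T))" using \<theta>z \<theta> by (intro mono) auto
    also have "\<dots> \<le> C * \<Psi> (4 * K) * \<Psi> (z * T)" using K T0 z by (intro delta) auto
    also have "\<dots> \<le> C * \<Psi> (4 * K) * (C * \<Psi> z * \<Psi> T)"
      using K T0 z C_gt by (intro mult_left_mono delta mult_nonneg_nonneg nonneg) auto
    also have "\<dots> = \<Psi> z * (C\<^sup>2 * \<Psi> (4 * K) * \<Psi> T)" by (simp add: power2_eq_square)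
    finally have \<Psi>\<theta>: "\<Psi> (4 * \<theta>) \<le> \<Psi> z * (C\<^sup>2 * \<Psi> (4 * K) * \<Psi> T)" .
    define B where "B = C\<^sup>2 * \<Psi> (4 * K) * \<Psi> T"
    have B: "0 \<le> B" unfolding B_def using K T by (intro mult_nonneg_nonneg nonneg) auto
    have "(\<integral>\<^sup>+x\<in>E. ennreal \<bar>g x\<bar> \<partial>lebesgue) * ennreal (\<Psi> (4 * \<theta>))
        \<le> (ennreal r * max_fun g \<Omega> r) * ennreal (\<Psi> z * B)"
      using \<Psi>\<theta> by (intro mult_mono Eg ennreal_leI) (auto simp: B_def)
    also have "\<dots> = (max_fun g \<Omega> r * ennreal (r * \<Psi> z)) * ennreal B"
      using E nonneg[OF z] B by (simp add: ennreal_mult mult_ac)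
    also have "\<dots> \<le> X * ennreal B"
      using supr False by (intro mult_right_mono) (auto simp: eta_def Z_def z_def)
    also have "\<dots> = ennreal (C\<^sup>2 * \<Psi> (4 * K) * enn2real X * \<Psi> T)"
    proof -
      have "X * ennreal B = ennreal (enn2real X) * ennreal B" using X by simp
      also have "\<dots> = ennreal (enn2real X * B)" using B by (simp add: ennreal_mult'')
      also have "enn2real X * B = C\<^sup>2 * \<Psi> (4 * K) * enn2real X * \<Psi> T" by (simp add: B_def)
      finally show ?thesis .
    qed
    finally show ?thesis by (simp add: X_def)
  qed
qed

theorem theorem1p9:
  fixes \<Phi> \<Psi> :: "real \<Rightarrow> real"
  assumes N2: "DIM('a::euclidean_space) \<ge> 2"
    and young: "young_function \<Phi>" "young_function \<Psi>"
    and conj_finite: "\<forall>t\<ge>0. bdd_above ((\<lambda>s. s * t - \<Phi> s) ` {0<..})"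
    and dp: "delta_prime \<Phi>" "delta_prime (young_conj \<Phi>)" "delta_prime \<Psi>"
    and ll: "young_ll \<Phi> \<Psi>"
  shows "\<exists>C>0. \<forall>(\<Omega>::'a set) g u.
     open \<Omega> \<longrightarrow>
     (emeasure lebesgue \<Omega> = \<infinity> \<longrightarrow>
        (\<integral>\<^sup>+ s \<in> {0<..1}. ennreal ((s / \<Phi> s) powr (1 / (real DIM('a) - 1))) \<partial>lborel) < \<infinity>) \<longrightarrow>
     (\<exists>L::real. (eta DIM('a) \<Phi> \<Psi> (emeasure lebesgue \<Omega>) \<longlongrightarrow> ennreal L) (at_right 0)) \<longrightarrow>
     g \<in> X_space \<Phi> \<Psi> \<Omega> \<longrightarrow>
     u \<in> C1c \<Omega> \<longrightarrow>
     (\<integral>\<^sup>+ x \<in> \<Omega>. ennreal (\<bar>g x\<bar> * \<Psi> \<bar>u x\<bar>) \<partial>lebesgue) < \<infinity> \<and>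
     young_inv \<Psi> (enn2real (\<integral>\<^sup>+ x \<in> \<Omega>. ennreal (\<bar>g x\<bar> * \<Psi> \<bar>u x\<bar>) \<partial>lebesgue))
       \<le> C * max (enn2real (X_norm \<Phi> \<Psi> \<Omega> g))
                  (enn2real (X_norm \<Phi> \<Psi> \<Omega> g) powr (1 / P_index \<Psi>))
           * young_inv \<Phi> (enn2real (\<integral>\<^sup>+ x \<in> \<Omega>. ennreal (\<Phi> (norm (grad u x))) \<partial>lebesgue))"
proof -

  \<comment> \<open>Constants from the hypotheses and the capacity bound\<close>
  obtain C1 where C1: "1 < C1" "\<And>s t. 0 \<le> s \<Longrightarrow> 0 \<le> t \<Longrightarrow> \<Phi> (s * t) \<le> C1 * \<Phi> s * \<Phi> t"
    using dp(1) unfolding delta_prime_def by blast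
  obtain D where D: "1 < D" "\<And>s t. 0 \<le> s \<Longrightarrow> 0 \<le> t \<Longrightarrow> young_conj \<Phi> (s * t) \<le> D * young_conj \<Phi> s * young_conj \<Phi> t"
    using dp(2) unfolding delta_prime_def by blast
  obtain C2 where C2: "1 < C2" "\<And>s t. 0 \<le> s \<Longrightarrow> 0 \<le> t \<Longrightarrow> \<Psi> (s * t) \<le> C2 * \<Psi> s * \<Psi> t"
    using dp(3) unfolding delta_prime_def by blast
  have dens: "is_young_density \<Phi> (young_density \<Phi>)" "is_young_density \<Psi> (young_density \<Psi>)"
    unfolding young_density_def
    using young someI_ex[of "is_young_density \<Phi>"] someI_ex[of "is_young_density \<Psi>"]
    by (simp_all add: young_function_def)
  interpret Phi: young_fun_delta \<Phi> "young_density \<Phi>" C1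
    using dens C1 by unfold_locales
  interpret Psi: young_fun_delta \<Psi> "young_density \<Psi>" C2
    using dens C2 by unfold_locales
  have bdd: "bdd_above ((\<lambda>s. s * t - \<Phi> s) ` {0<..})" if "0 \<le> t" for t
    by (rule conj_finite[rule_format, OF that])
  from ll obtain C3 where C3: "0 < C3"
    and C3_ll: "\<forall>a. (\<forall>i. 0 \<le> a i) \<longrightarrow> summable a \<longrightarrow> summable (\<lambda>i. \<Psi> (young_inv \<Phi> (a i))) \<and>
      (\<Sum>i. \<Psi> (young_inv \<Phi> (a i))) \<le> C3 * \<Psi> (young_inv \<Phi> (\<Sum>i. a i))"
    unfolding young_ll_def by (elim exE conjE)
  have summ: "summable (\<lambda>i. \<Psi> (young_inv \<Phi> (a i)))"
    and C3_le: "(\<Sum>i. \<Psi> (young_inv \<Phi> (a i))) \<le> C3 * \<Psi> (young_inv \<Phi> (\<Sum>i. a i))"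
    if "\<And>i. 0 \<le> a i" "summable a" for a
    using spec[OF C3_ll, of a] that by simp_all
  obtain K where K: "0 < K" and capacity: "\<And>(u :: 'a \<Rightarrow> real) G R \<theta> r m l e.
      (\<And>y. (u has_derivative (\<lambda>h. G y \<bullet> h)) (at y)) \<Longrightarrow> continuous_on UNIV G \<Longrightarrow>
      (\<And>y. R \<le> norm y \<Longrightarrow> u y = 0) \<Longrightarrow> 0 < \<theta> \<Longrightarrow>
      emeasure lborel {x. 2 * \<theta> < \<bar>u x\<bar>} = ennreal r \<Longrightarrow> 0 < r \<Longrightarrow>
      ennreal r + emeasure lborel {x. \<theta> < \<bar>u x\<bar> \<and> \<bar>u x\<bar> \<le> 2 * \<theta>} \<le> m \<Longrightarrow>
      emeasure lborel {x. \<theta> < \<bar>u x\<bar> \<and> \<bar>u x\<bar> \<le> 2 * \<theta>} < \<infinity> \<Longrightarrow>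
      0 < l \<Longrightarrow> (\<integral>\<^sup>+s\<in>{s. r < s \<and> ennreal s < m}.
        ennreal (young_conj \<Phi> (\<bar>s powr (1 / real DIM('a) - 1)\<bar> / l)) \<partial>lborel) \<le> 1 \<Longrightarrow>
      (\<integral>\<^sup>+x\<in>{x. \<theta> < \<bar>u x\<bar> \<and> \<bar>u x\<bar> \<le> 2 * \<theta>}. ennreal (\<Phi> (norm (G x))) \<partial>lborel) = ennreal e \<Longrightarrow>
      0 \<le> e \<Longrightarrow> \<theta> \<le> K * l * young_inv \<Phi> e"
    using Phi.level_le_inv_energy[OF N2 bdd D] by blast
  define B where "B = C2\<^sup>2 * \<Psi> (4 * K)"
  have B: "0 \<le> B" unfolding B_def using K by (intro mult_nonneg_nonneg Psi.nonneg) auto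
  \<comment> \<open>Built from \<open>\<Phi>\<close>, \<open>\<Psi>\<close> and the dimension only;
    it is at least 1 so that superlinearity can move it inside \<open>\<Psi>\<close>.\<close>
  define Cf where "Cf = max 1 (B * C3)"
  have Cf: "1 \<le> Cf" "B * C3 \<le> Cf" by (auto simp: Cf_def)
  have P: "0 < P_index \<Psi>" "\<And>t. 0 < t \<Longrightarrow> t * young_density \<Psi> t \<le> P_index \<Psi> * \<Psi> t"
    using P_index_bound[OF Psi.young_fun_delta_axioms] by auto
  have main: "(\<integral>\<^sup>+ x \<in> \<Omega>. ennreal (\<bar>g x\<bar> * \<Psi> \<bar>u x\<bar>) \<partial>lebesgue) < \<infinity> \<and>
     young_inv \<Psi> (enn2real (\<integral>\<^sup>+ x \<in> \<Omega>. ennreal (\<bar>g x\<bar> * \<Psi> \<bar>u x\<bar>) \<partial>lebesgue))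
       \<le> Cf * max (enn2real (X_norm \<Phi> \<Psi> \<Omega> g))
                  (enn2real (X_norm \<Phi> \<Psi> \<Omega> g) powr (1 / P_index \<Psi>))
           * young_inv \<Phi> (enn2real (\<integral>\<^sup>+ x \<in> \<Omega>. ennreal (\<Phi> (norm (grad u x))) \<partial>lebesgue))"
    if \<Omega>: "open \<Omega>" and g: "g \<in> X_space \<Phi> \<Psi> \<Omega>" and u: "u \<in> C1c \<Omega>" for \<Omega> :: "'a set" and g u
  proof -

    \<comment> \<open>Regularity of \<open>u\<close> and finiteness of the energy\<close>
    obtain S where S: "compact S" "S \<subseteq> \<Omega>" and u0: "\<And>y. y \<notin> S \<Longrightarrow> u y = 0"
      and g0: "\<And>y. y \<notin> S \<Longrightarrow> grad u y = 0"
      and der: "\<And>y. (u has_derivative (\<lambda>h. grad u y \<bullet> h)) (at y)" and cont: "continuous_on UNIV (grad u)"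
      using C1c_grad[OF \<Omega> u] by metis
    obtain R where R: "\<And>y. R \<le> norm y \<Longrightarrow> u y = 0"
    proof -
      obtain b where "\<And>y. y \<in> S \<Longrightarrow> norm y \<le> b" using compact_imp_bounded[OF S(1)] by (auto simp: bounded_iff)
      then have "u y = 0" if "b + 1 \<le> norm y" for y using that by (intro u0) force
      then show ?thesis using that by blast
    qed
    have contu: "continuous_on UNIV u"
      using der by (auto simp: continuous_on_eq_continuous_at intro: has_derivative_continuous)
    have [measurable]: "u \<in> borel_measurable borel"
      using contu by (rule borel_measurable_continuous_onI)
    have contPhi: "continuous_on UNIV (\<lambda>x. \<Phi> (norm (grad u x)))"
      by (intro continuous_on_compose2[OF Phi.continuous_on_nonneg] continuous_intros cont) auto
    then have [measurable]: "(\<lambda>x. \<Phi> (norm (grad u x))) \<in> borel_measurable borel"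
      by (rule borel_measurable_continuous_onI)
    have [measurable]: "\<Omega> \<in> sets borel" using \<Omega> by simp
    have Sfin: "emeasure lborel S < \<infinity>" by (rule emeasure_compact_finite[OF S(1)])
    have [measurable]: "S \<in> sets borel" using S(1) by (simp add: compact_imp_closed)

    \<comment> \<open>Integrated against \<open>lborel\<close>;
      \<open>nn_integral_completion\<close> identifies it with the integral over
      \<open>lebesgue\<close> in the claim.\<close>
    define I where "I = (\<integral>\<^sup>+ x \<in> \<Omega>. ennreal (\<Phi> (norm (grad u x))) \<partial>lborel)"
    have Ifin: "I < \<infinity>"
    proof -
      have "compact ((\<lambda>x. \<Phi> (norm (grad u x))) ` S)"
        by (intro compact_continuous_image continuous_on_subset[OF contPhi] S) auto
      then have "bdd_above ((\<lambda>x. \<Phi> (norm (grad u x))) ` S)"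
        by (intro bounded_imp_bdd_above compact_imp_bounded)
      then obtain b where b: "\<And>x. x \<in> S \<Longrightarrow> \<Phi> (norm (grad u x)) \<le> b"
        by (auto simp: bdd_above_def)
      have "I \<le> (\<integral>\<^sup>+ x. ennreal b * indicator S x \<partial>lborel)"
        unfolding I_def by (intro nn_integral_mono)
          (use g0 b in \<open>auto split: split_indicator simp: Phi.at_zero intro!: ennreal_leI\<close>)
      also have "\<dots> = ennreal b * emeasure lborel S" by (subst nn_integral_cmult_indicator) auto
      also have "\<dots> < \<infinity>" using Sfin by (simp add: ennreal_mult_less_top)
      finally show ?thesis .
    qed

    \<comment> \<open>Dyadic levels of \<open>|u|\<close> and their energies\<close>
    obtain M where M: "0 < M" "\<And>x. \<bar>u x\<bar> \<le> M"
    proof -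
      have "compact (u ` S)"
        by (intro compact_continuous_image continuous_on_subset[OF contu] S) auto
      then obtain b where b: "\<And>x. x \<in> S \<Longrightarrow> \<bar>u x\<bar> \<le> b"
        using compact_imp_bounded[of "u ` S"] by (auto simp: bounded_iff)
      have "\<bar>u x\<bar> \<le> max 1 b" for x using b[of x] u0[of x] by (cases "x \<in> S") auto
      then show ?thesis using that[of "max 1 b"] by auto
    qed
    \<comment> \<open>The shift by 2 makes \<open>4 * \<theta> i = M / 2 ^ i\<close> and
      \<open>2 * \<theta> i = M / 2 ^ (i + 1)\<close>: the dyadic shell between these heights lies
      in \<open>E i\<close>, while \<open>F i\<close>, the shell just below, supplies the
      gradient.\<close>
    define \<theta> where "\<theta> i = M / 2 ^ (i + 2)" for i :: nat
    define F where "F i = {x. \<theta> i < \<bar>u x\<bar> \<and> \<bar>u x\<bar> \<le> 2 * \<theta> i}" for i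
    define E where "E i = {x. 2 * \<theta> i < \<bar>u x\<bar>}" for i
    have \<theta>: "0 < \<theta> i" for i using M by (simp add: \<theta>_def)
    have [measurable]: "E i \<in> sets borel" "F i \<in> sets borel" for i
      unfolding E_def F_def by measurable
    have ES: "E i \<subseteq> S" and FS: "F i \<subseteq> S" for i
      using u0 \<theta>[of i] by (force simp: E_def F_def)+
    define e where "e i = enn2real (\<integral>\<^sup>+x\<in>F i. ennreal (\<Phi> (norm (grad u x))) \<partial>lborel)" for i
    have e0: "0 \<le> e i" for i by (simp add: e_def)
    have eF: "(\<integral>\<^sup>+x\<in>F i. ennreal (\<Phi> (norm (grad u x))) \<partial>lborel) = ennreal (e i)" for i
    proof -
      have "(\<integral>\<^sup>+x\<in>F i. ennreal (\<Phi> (norm (grad u x))) \<partial>lborel) \<le> I"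
        unfolding I_def by (intro nn_integral_mono) (use FS S in \<open>fastforce split: split_indicator\<close>)
      then show ?thesis using Ifin by (auto simp: e_def intro: le_less_trans)
    qed
    have disj: "disjoint_family F"
      unfolding disjoint_family_on_def
    proof (intro ballI impI)
      have *: "F i \<inter> F j = {}" if "i < j" for i j
      proof -
        have "2 * \<theta> j \<le> \<theta> i"
          using that M power_increasing[of "i + 1" j "2::real"] by (simp add: \<theta>_def field_simps)
        then show ?thesis by (auto simp: F_def)
      qed
      show "F i \<inter> F j = {}" if "i \<noteq> j" for i j
        using *[of i j] *[of j i] that by (cases i j rule: linorder_cases) auto
    qed
    \<comment> \<open>The shells \<open>F i\<close> are disjoint, so their energies add up to at
      most the total.\<close>
    have sum_e: "(\<Sum>i. ennreal (e i)) \<le> I"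
    proof -
      have "(\<Sum>i. ennreal (e i)) = (\<integral>\<^sup>+x. (\<Sum>i. ennreal (\<Phi> (norm (grad u x))) * indicator (F i) x) \<partial>lborel)"
        unfolding eF[symmetric] by (intro nn_integral_suminf[symmetric]) measurable
      also have "\<dots> = (\<integral>\<^sup>+x. ennreal (\<Phi> (norm (grad u x))) * indicator (\<Union>i. F i) x \<partial>lborel)"
        by (simp add: ennreal_suminf_cmult suminf_indicator[OF disj])
      also have "\<dots> \<le> I"
        unfolding I_def by (intro nn_integral_mono) (use FS S in \<open>fastforce split: split_indicator\<close>)
      finally show ?thesis .
    qed
    have e_summable: "summable e"
      using sum_e Ifin e0 by (intro summable_suminf_not_top) (auto simp: top_unique)
    have "ennreal (\<Sum>i. e i) \<le> I"
      using sum_e e0 e_summable by (simp add: suminf_ennreal2)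
    then have sum_e': "(\<Sum>i. e i) \<le> enn2real I"
      using Ifin by (cases I) (auto simp: ennreal_le_iff suminf_nonneg e0 e_summable)

    \<comment> \<open>The estimate on a single level\<close>
    define X where "X = enn2real (X_norm \<Phi> \<Psi> \<Omega> g)"
    have X0: "0 \<le> X" by (simp add: X_def)
    define T where "T = young_inv \<Phi> (enn2real I)"
    have T0: "0 \<le> T" unfolding T_def by (rule Phi.inv_nonneg) simp
    have level: "(\<integral>\<^sup>+x\<in>E i. ennreal \<bar>g x\<bar> \<partial>lebesgue) * ennreal (\<Psi> (4 * \<theta> i))
        \<le> ennreal (B * X * \<Psi> (young_inv \<Phi> (e i)))" for i
    proof -
      have "emeasure lborel (E i) \<le> emeasure lborel S" using ES by (intro emeasure_mono) auto
      then obtain r where r: "emeasure lborel (E i) = ennreal r" "0 \<le> r"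
        using Sfin by (cases "emeasure lborel (E i)") (auto simp: top_unique)
      have Ffin: "emeasure lborel (F i) < \<infinity>"
        using emeasure_mono[OF FS[of i], of lborel] Sfin by (auto intro: le_less_trans)
      show ?thesis
      proof (cases "r = 0")
        case True
        \<comment> \<open>The capacity bound needs positive measure; a null level contributes
          nothing.\<close>
        have ae: "AE x in lebesgue. x \<notin> E i"
          using True r by (intro AE_not_in) (simp add: null_setsI)
        have "(\<integral>\<^sup>+x\<in>E i. ennreal \<bar>g x\<bar> \<partial>lebesgue) = (\<integral>\<^sup>+x. 0 \<partial>(lebesgue :: 'a measure))"
          by (rule nn_integral_cong_AE) (use ae in \<open>auto elim!: eventually_mono\<close>)
        then show ?thesis by simp
      next
        case False
        have rm: "ennreal r + emeasure lborel (F i) \<le> emeasure lebesgue \<Omega>"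
        proof -
          have "ennreal r + emeasure lborel (F i) = emeasure lborel (E i \<union> F i)"
            unfolding r(1)[symmetric] by (rule plus_emeasure) (auto simp: E_def F_def)
          also have "\<dots> \<le> emeasure lborel \<Omega>" using ES[of i] FS[of i] S by (intro emeasure_mono) auto
          finally show ?thesis by simp
        qed
        show ?thesis
          unfolding B_def X_def
        proof (rule weighted_level_estimate[OF Psi.young_fun_delta_axioms \<Omega> g _ _ _ _ K _ \<theta>])
          show "0 \<le> young_inv \<Phi> (e i)" by (rule Phi.inv_nonneg[OF e0])
          show "E i \<in> sets lebesgue" by simp
          show "E i \<subseteq> \<Omega>" using ES S by blast
          show "emeasure lebesgue (E i) = ennreal r" using r by simp
          show "0 < r" using False r by simp
          fix l :: real
          assume l: "0 < l" "(\<integral>\<^sup>+s\<in>{s. r < s \<and> ennreal s < emeasure lebesgue \<Omega>}.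
            ennreal (young_conj \<Phi> (\<bar>s powr (1 / real DIM('a) - 1)\<bar> / l)) \<partial>lborel) \<le> 1"
          show "\<theta> i \<le> K * l * young_inv \<Phi> (e i)"
            by (rule capacity[OF der cont R \<theta> r(1)[unfolded E_def] \<open>0 < r\<close> rm[unfolded F_def]
                  Ffin[unfolded F_def] l eF[unfolded F_def] e0])
        qed
      qed
    qed

    \<comment> \<open>Summation over the levels\<close>
    have gm: "(\<lambda>x. ennreal \<bar>g x\<bar> * indicator (E i) x) \<in> borel_measurable lebesgue" for i
      using g ES[of i] S(2) by (intro borel_measurable_abs_indicator[of \<Omega>]) (auto simp: X_space_def)
    have pointwise: "ennreal (\<bar>g x\<bar> * \<Psi> \<bar>u x\<bar>) * indicator \<Omega> x
        \<le> (\<Sum>i. ennreal \<bar>g x\<bar> * indicator (E i) x * ennreal (\<Psi> (4 * \<theta> i)))" for x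
    proof (cases "u x = 0")
      case False
      have "\<exists>i. M / 2 ^ (i + 1) < \<bar>u x\<bar>"
      proof -
        obtain n where "M / \<bar>u x\<bar> < 2 ^ n" using real_arch_pow[of 2 "M / \<bar>u x\<bar>"] by auto
        then have "M < 2 ^ n * \<bar>u x\<bar>" using False by (simp add: field_simps)
        also have "\<dots> \<le> 2 ^ (n + 1) * \<bar>u x\<bar>" by simp
        finally show ?thesis by (intro exI[of _ n]) (simp add: field_simps)
      qed
      \<comment> \<open>The first dyadic height exceeded by \<open>|u x|\<close>; minimality gives
        \<open>|u x| \<le> M / 2 ^ i\<close>, with the bound \<open>M\<close> in place of minimality
        when \<open>i = 0\<close>.\<close>
      define i where "i = (LEAST i. M / 2 ^ (i + 1) < \<bar>u x\<bar>)"
      have i: "M / 2 ^ (i + 1) < \<bar>u x\<bar>" unfolding i_def by (rule LeastI_ex) fact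
      have "\<bar>u x\<bar> \<le> M / 2 ^ i"
      proof (cases i)
        case 0 then show ?thesis using M by simp
      next
        case (Suc j)
        then have "\<not> M / 2 ^ (j + 1) < \<bar>u x\<bar>" 
          using not_less_Least[of j "\<lambda>i. M / 2 ^ (i + 1) < \<bar>u x\<bar>"] unfolding i_def by simp
        then show ?thesis using Suc by simp
      qed
      then have "\<Psi> \<bar>u x\<bar> \<le> \<Psi> (4 * \<theta> i)" by (intro Psi.mono) (auto simp: \<theta>_def)
      then have "ennreal (\<bar>g x\<bar> * \<Psi> \<bar>u x\<bar>) \<le> ennreal \<bar>g x\<bar> * ennreal (\<Psi> (4 * \<theta> i))"
        by (simp add: ennreal_mult' mult_left_mono ennreal_leI)
      moreover have "x \<in> E i" using i by (simp add: E_def \<theta>_def)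
      ultimately have "ennreal (\<bar>g x\<bar> * \<Psi> \<bar>u x\<bar>) * indicator \<Omega> x
          \<le> ennreal \<bar>g x\<bar> * indicator (E i) x * ennreal (\<Psi> (4 * \<theta> i))"
        by (auto split: split_indicator)
      also have "\<dots> \<le> (\<Sum>i. ennreal \<bar>g x\<bar> * indicator (E i) x * ennreal (\<Psi> (4 * \<theta> i)))"
        using sum_le_suminf[of "\<lambda>i. ennreal \<bar>g x\<bar> * indicator (E i) x * ennreal (\<Psi> (4 * \<theta> i))" "{i}"] by simp
      finally show ?thesis .
    qed (simp add: Psi.at_zero)
    define J where "J = (\<integral>\<^sup>+ x \<in> \<Omega>. ennreal (\<bar>g x\<bar> * \<Psi> \<bar>u x\<bar>) \<partial>lebesgue)"
    have inv0: "0 \<le> \<Psi> (young_inv \<Phi> (e i))" for i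
      by (intro Psi.nonneg Phi.inv_nonneg e0)
    have "J \<le> (\<integral>\<^sup>+x. (\<Sum>i. ennreal \<bar>g x\<bar> * indicator (E i) x * ennreal (\<Psi> (4 * \<theta> i))) \<partial>lebesgue)"
      unfolding J_def by (intro nn_integral_mono pointwise)
    also have "\<dots> = (\<Sum>i. \<integral>\<^sup>+x. ennreal \<bar>g x\<bar> * indicator (E i) x * ennreal (\<Psi> (4 * \<theta> i)) \<partial>lebesgue)"
      by (intro nn_integral_suminf borel_measurable_times_ennreal gm) simp
    also have "\<dots> = (\<Sum>i. (\<integral>\<^sup>+x\<in>E i. ennreal \<bar>g x\<bar> \<partial>lebesgue) * ennreal (\<Psi> (4 * \<theta> i)))"
      by (simp only: nn_integral_multc[OF gm])
    also have "\<dots> \<le> (\<Sum>i. ennreal (B * X * \<Psi> (young_inv \<Phi> (e i))))"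
      by (intro suminf_le level) auto
    also have "\<dots> = ennreal (\<Sum>i. B * X * \<Psi> (young_inv \<Phi> (e i)))"
      using B X0 inv0 by (intro suminf_ennreal2 mult_nonneg_nonneg summable_mult summ e0 e_summable)
    also have "(\<Sum>i. B * X * \<Psi> (young_inv \<Phi> (e i))) = B * X * (\<Sum>i. \<Psi> (young_inv \<Phi> (e i)))"
      by (intro suminf_mult summ e0 e_summable)
    also have "\<dots> \<le> B * X * (C3 * \<Psi> T)"
    proof (rule mult_left_mono)
      \<comment> \<open>\<open>\<Phi> << \<Psi>\<close> for the sequence of shell energies, whose
        sum is at most the total energy.\<close>
      have "(\<Sum>i. \<Psi> (young_inv \<Phi> (e i))) \<le> C3 * \<Psi> (young_inv \<Phi> (\<Sum>i. e i))"
        by (intro C3_le e0 e_summable)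
      also have "\<dots> \<le> C3 * \<Psi> T"
        using C3 unfolding T_def
        by (intro mult_left_mono Psi.mono Phi.inv_mono Phi.inv_nonneg sum_e' suminf_nonneg e_summable e0) auto
      finally show "(\<Sum>i. \<Psi> (young_inv \<Phi> (e i))) \<le> C3 * \<Psi> T" .
    qed (use B X0 in simp)
    also have "\<dots> \<le> Cf * (X * \<Psi> T)"
      using mult_right_mono[OF Cf(2), of "X * \<Psi> T"] X0 Psi.nonneg[OF T0] by (simp add: mult_ac)
    finally have J: "J \<le> ennreal (Cf * (X * \<Psi> T))" by (simp add: ennreal_leI)
    have Y0: "0 \<le> Cf * (X * \<Psi> T)" using Cf X0 Psi.nonneg[OF T0] by simp

    \<comment> \<open>From \<open>X * \<Psi> T\<close> to the maximum in the claim\<close>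
    have "X * \<Psi> T \<le> \<Psi> (max X (X powr (1 / P_index \<Psi>)) * T)"
    proof -
      \<comment> \<open>For \<open>0 < X < 1\<close> write \<open>X\<close> as the
        \<open>P\<close>-th power of \<open>X powr (1 / P)\<close> and use
        \<open>scale_down\<close>; for \<open>1 \<le> X\<close> superlinearity suffices.\<close>
      consider "X = 0" | "0 < X" "X < 1" | "1 \<le> X" using X0 by linarith
      then show ?thesis
      proof cases
        case 1
        then show ?thesis using T0 by (auto intro!: Psi.nonneg)
      next
        case 2
        have "X * \<Psi> T = (X powr (1 / P_index \<Psi>)) powr P_index \<Psi> * \<Psi> T"
          using 2 P by (simp add: powr_powr)
        also have "\<dots> \<le> \<Psi> (X powr (1 / P_index \<Psi>) * T)"
          using 2 P T0 by (intro Psi.scale_down) (auto simp: powr_le1)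
        also have "\<dots> \<le> \<Psi> (max X (X powr (1 / P_index \<Psi>)) * T)"
          using T0 by (intro Psi.mono mult_right_mono) auto
        finally show ?thesis .
      next
        case 3
        have "X * \<Psi> T \<le> \<Psi> (X * T)" using 3 T0 by (rule Psi.scale_ge)
        also have "\<dots> \<le> \<Psi> (max X (X powr (1 / P_index \<Psi>)) * T)"
          using T0 X0 by (intro Psi.mono mult_right_mono) auto
        finally show ?thesis .
      qed
    qed
    then have "Cf * (X * \<Psi> T) \<le> Cf * \<Psi> (max X (X powr (1 / P_index \<Psi>)) * T)"
      using Cf by (intro mult_left_mono) auto
    also have "\<dots> \<le> \<Psi> (Cf * (max X (X powr (1 / P_index \<Psi>)) * T))"
      using Cf X0 T0 by (intro Psi.scale_ge) (auto simp: max_def)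
    finally have "enn2real J \<le> \<Psi> (Cf * (max X (X powr (1 / P_index \<Psi>)) * T))"
      using enn2real_leI[OF Y0 J] by simp
    then have "young_inv \<Psi> (enn2real J) \<le> Cf * (max X (X powr (1 / P_index \<Psi>)) * T)"
      using Cf X0 T0 by (intro Psi.inv_le) (auto simp: max_def)
    moreover have "J < \<infinity>" using J by (auto intro: le_less_trans)
    ultimately show ?thesis
      by (simp add: J_def X_def T_def I_def nn_integral_completion mult.assoc)
  qed
  show ?thesis
    using main Cf(1) by (intro exI[of _ Cf]) auto
qed

end
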